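(* Let $\{M_n\}_{n=0}^\infty$ be a sequence of moments of a probability measure on $\mathbb{R}$. Suppose that $M_n=0$ for every odd number $n$. Let $\{\omega_n\}_{n=1}^\infty$ denote the corresponding Jacobi sequence, and suppose that it is of infinite type (i.e. $\omega_n>0$ for all $n\geq 1$). Then the following conditions are equivalent: (1) the sequence $\{\omega_n\}_{n=1}^\infty$ has property (SC); (2) a probability measure $\mu$ on $\mathbb{R}$ satisfying $M_n=\int_{\mathbb{R}}x^n\,d\mu$ for all $n\ge 0$ is not unique.
   Context: Jacobi sequence: if a probability measure with moments $\{M_n\}$ has infinite support and all odd moments vanish, its monic orthogonal polynomials $P_0=1,P_1,\dots$ (which depend only on the moments) satisfy $xP_n(x)=P_{n+1}(x)+\omega_nP_{n-1}(x)$ for $n\ge0$ (with $P_{-1}=0$) for unique numbers $\omega_n>0$, $n\ge1$; $\{\omega_n\}_{n=1}^\infty$ is the corresponding Jacobi sequence. Property (SC): given $\{\omega_n\}_{n=1}^\infty$ with all $\omega_n>0$, define $B_{-1}=1$, $B_0=1$, $B_m=B_{m-1}+\omega_mB_{m-2}$ for $m\ge1$. The sequence $\{\omega_n\}$ has property (SC) if $\sum_{n=1}^\infty \frac{B_{n-1}}{B_n}<\infty$. (Equivalently, with $X_m$ the $(m+1)\times(m+1)$ symmetric tridiagonal matrix with zero diagonal and off-diagonal entries $\sqrt{\omega_1},\dots,\sqrt{\omega_m}$, and $G_m(i)$ the upper-left entry of $(i-X_m)^{-1}$, the limits $\lim_m G_{2m}(i)$ and $\lim_m G_{2m+1}(i)$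 are different; or equivalently $\lim_{m\to\infty}\prod_{n=1}^m(1-B_{n-1}/B_n)>0$.) *)

theory Defs
  imports "HOL-Probability.Probability" "HOL-Computational_Algebra.Polynomial"
begin

definition has_moments :: "real measure \<Rightarrow> (nat \<Rightarrow> real) \<Rightarrow> bool" where
  "has_moments \<mu> M \<longleftrightarrow>
     real_distribution \<mu> \<and> (\<forall>n. has_bochner_integral \<mu> (\<lambda>x. x ^ n) (M n))"

text \<open>The linear functional on polynomials with \<open>x ^ n \<mapsto> M n\<close>, that is, integration against
  any measure with moments \<open>M\<close>.\<close>

definition moment_functional :: "(nat \<Rightarrow> real) \<Rightarrow> real poly \<Rightarrow> real" where
  "moment_functional M p = (\<Sum>k\<le>degree p. coeff p k * M k)"

definition monic_orthogonal :: "(nat \<Rightarrow> real) \<Rightarrow> (nat \<Rightarrow> real poly) \<Rightarrow> bool" where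
  "monic_orthogonal M P \<longleftrightarrow>
     (\<forall>n. degree (P n) = n \<and> lead_coeff (P n) = 1) \<and>
     (\<forall>m n. m \<noteq> n \<longrightarrow> moment_functional M (P m * P n) = 0)"

text \<open>The first recurrence equation is the case \<open>n = 0\<close>, where \<open>P\<^sub>-\<^sub>1 = 0\<close>. The value
  \<open>\<omega> 0\<close> is not used. Positivity of \<open>\<omega> n\<close> for \<open>n \<ge> 1\<close> (infinite type) is not part of the
  definition; together with the recurrence and \<open>M 0 = 1\<close> it makes the moment functional positive definite, so
  that \<open>P\<close> and the values \<open>\<omega> n\<close> for \<open>n \<ge> 1\<close> are unique.\<close>

definition jacobi_sequence :: "(nat \<Rightarrow> real) \<Rightarrow> (nat \<Rightarrow> real) \<Rightarrow> bool" where
  "jacobi_sequence M \<omega> \<longleftrightarrow>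
     (\<exists>P. monic_orthogonal M P \<and>
          [:0, 1:] * P 0 = P 1 \<and>
          (\<forall>n\<ge>1. [:0, 1:] * P n = P (n + 1) + smult (\<omega> n) (P (n - 1))))"

text \<open>The value at \<open>1\<close> is \<open>B\<^sub>1 = B\<^sub>0 + \<omega>\<^sub>1 B\<^sub>-\<^sub>1\<close> with \<open>B\<^sub>-\<^sub>1 = B\<^sub>0 = 1\<close>.\<close>

fun B_seq :: "(nat \<Rightarrow> real) \<Rightarrow> nat \<Rightarrow> real" where
  "B_seq \<omega> 0 = 1"
| "B_seq \<omega> (Suc 0) = 1 + \<omega> 1"
| "B_seq \<omega> (Suc (Suc m)) = B_seq \<omega> (Suc m) + \<omega> (Suc (Suc m)) * B_seq \<omega> m"

text \<open>The series over \<open>n \<ge> 1\<close> is reindexed to start at \<open>0\<close>.\<close>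

definition property_SC :: "(nat \<Rightarrow> real) \<Rightarrow> bool" where
  "property_SC \<omega> \<longleftrightarrow> summable (\<lambda>n. B_seq \<omega> n / B_seq \<omega> (Suc n))"

end

theory Submission
  imports Defs
begin

text \<open>
  Write \<open>P\<^sub>n(i) = i\<^sup>n den n\<close>.  The recurrence gives \<open>den (n + 1) = B\<^sub>n\<close>, so (SC) is a
  statement about the size of the orthogonal polynomials at \<open>i\<close>.  With \<open>h n = \<omega>\<^sub>1 \<cdots> \<omega>\<^sub>n\<close>, the
  squared norm of \<open>P\<^sub>n\<close>, the sums \<open>kernel n = (\<Sum>k\<le>n. (den k)\<^sup>2 / h k)\<close> are the diagonal values at \<open>i\<close> of the
  reproducing kernel of the polynomials of degree at most \<open>n\<close>, and they telescope to
  \<open>den n \<cdot> den (n + 1) / h n\<close>.  Hence \<open>B\<^sub>n / B\<^sub>n\<^sub>+\<^sub>1\<close> is the relative increment of \<open>kernel\<close> from \<open>n\<close> to \<open>n + 1\<close>, and (SC)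
  says that the kernel stays bounded (\<open>property_SC_iff_kernel_bounded\<close>).  It remains to relate
  boundedness of the kernel to indeterminacy, which is done with real polynomials and the
  functions \<open>1 / (1 + x\<^sup>2)\<close> and \<open>x / (1 + x\<^sup>2)\<close> in place of the Stieltjes transform.

  Bounded kernel: the Gauss measure at the zeros of \<open>P\<^sub>n\<close> has the moments \<open>M\<close> up to order \<open>2n - 1\<close>,
  and its integral of \<open>1 / (1 + x\<^sup>2)\<close> is the \<open>n\<close>-th convergent of the continued fraction
  \<open>1 / (1 + \<omega>\<^sub>1 / (1 + \<omega>\<^sub>2 / \<dots>))\<close>.  Consecutive convergents differ by \<open>1 / kernel n\<close> up to sign.
  Limit points of the Gauss measures, which exist by Helly's theorem, have all the moments \<open>M\<close>.  Passing to the
  limit along some indices and along their successors yields two solutions that are told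
  apart by \<open>1 / (1 + x\<^sup>2)\<close> (\<open>kernel_bounded_imp_not_unique\<close>).

  Unbounded kernel: dividing the reproducing kernel at \<open>i\<close> by \<open>kernel N\<close> gives polynomials with
  value \<open>1\<close> at \<open>i\<close> whose \<open>L\<^sup>2\<close> norm tends to \<open>0\<close>.  Division by \<open>1 + x\<^sup>2\<close> turns them
  into polynomial approximations of \<open>1 / (1 + x\<^sup>2)\<close>, valid for all solutions simultaneously.
  By induction on \<open>k\<close> all solutions give the same integrals to \<open>p / (1 + x\<^sup>2)\<^sup>k\<close>
  (\<open>rational_integrals_determined\<close>), and these functions determine a measure by the
  Stone--Weierstrass theorem (\<open>real_distribution_eqI_rational\<close>).
\<close>

section \<open>The moment functional\<close>

lemma has_moments_real_distribution: "has_moments \<nu> M \<Longrightarrow> real_distribution \<nu>"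
  by (simp add: has_moments_def)

lemma has_moments_poly:
  assumes "has_moments \<nu> M"
  shows "has_bochner_integral \<nu> (poly p) (moment_functional M p)"
proof -
  have "has_bochner_integral \<nu> (\<lambda>x. \<Sum>k\<le>degree p. coeff p k * x ^ k) (\<Sum>k\<le>degree p. coeff p k * M k)"
    using assms unfolding has_moments_def
    by (intro has_bochner_integral_sum has_bochner_integral_mult_right) auto
  moreover have "poly p = (\<lambda>x. \<Sum>k\<le>degree p. coeff p k * x ^ k)"
    by (simp add: fun_eq_iff poly_altdef)
  ultimately show ?thesis
    by (simp add: moment_functional_def)
qed

lemma has_moments_integrable_poly: "has_moments \<nu> M \<Longrightarrow> integrable \<nu> (poly p)"
  using has_moments_poly has_bochner_integral_iff by blast

lemma has_moments_integral_poly: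
  "has_moments \<nu> M \<Longrightarrow> integral\<^sup>L \<nu> (poly p) = moment_functional M p"
  using has_moments_poly has_bochner_integral_iff by blast

text \<open>The solution \<open>\<mu>\<close> serves to transfer linearity and positivity of the integral to the moment
  functional; every statement about \<open>L\<close> then applies to all solutions.\<close>

locale jacobi_moment_problem =
  fixes \<mu> :: "real measure" and M \<omega> :: "nat \<Rightarrow> real" and P :: "nat \<Rightarrow> real poly"
  assumes moments: "has_moments \<mu> M"
    and orthogonal: "monic_orthogonal M P"
    and recurrence_0: "[:0, 1:] * P 0 = P 1"
    and recurrence: "\<And>n. n \<ge> 1 \<Longrightarrow> [:0, 1:] * P n = P (n + 1) + smult (\<omega> n) (P (n - 1))"
    and pos: "\<And>n. n \<ge> 1 \<Longrightarrow> \<omega> n > 0"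
begin

abbreviation L :: "real poly \<Rightarrow> real" where "L \<equiv> moment_functional M"

lemma L_add: "L (p + q) = L p + L q"
proof -
  have "poly (p + q) = (\<lambda>x. poly p x + poly q x)"
    by (simp add: fun_eq_iff)
  then have "integral\<^sup>L \<mu> (poly (p + q)) = integral\<^sup>L \<mu> (poly p) + integral\<^sup>L \<mu> (poly q)"
    using has_moments_integrable_poly[OF moments] by simp
  then show ?thesis
    by (simp add: has_moments_integral_poly[OF moments])
qed

lemma L_smult: "L (smult c p) = c * L p"
proof -
  have "poly (smult c p) = (\<lambda>x. c * poly p x)"
    by (simp add: fun_eq_iff)
  then have "integral\<^sup>L \<mu> (poly (smult c p)) = c * integral\<^sup>L \<mu> (poly p)"
    by simp
  then show ?thesis
    by (simp add: has_moments_integral_poly[OF moments])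
qed

lemma L_0 [simp]: "L 0 = 0"
  by (simp add: moment_functional_def)

lemma L_sum: "L (\<Sum>i\<in>A. f i) = (\<Sum>i\<in>A. L (f i))"
  by (induction A rule: infinite_finite_induct) (auto simp: L_add)

lemma L_1 [simp]: "L 1 = 1"
proof -
  interpret real_distribution \<mu>
    using moments by (rule has_moments_real_distribution)
  have "poly 1 = (\<lambda>x. 1 :: real)"
    by auto
  then have "L 1 = (\<integral>x. 1 \<partial>\<mu>)"
    using has_moments_integral_poly[OF moments, of 1] by simp
  then show ?thesis
    using prob_space by simp
qed

lemma L_square_nonneg: "L (p * p) \<ge> 0"
proof -
  have "0 \<le> integral\<^sup>L \<mu> (poly (p * p))"
    by (rule integral_nonneg_AE) auto
  then show ?thesis
    by (simp add: has_moments_integral_poly[OF moments])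
qed

lemma degree_P [simp]: "degree (P n) = n"
  using orthogonal by (simp add: monic_orthogonal_def)

lemma coeff_P [simp]: "coeff (P n) n = 1"
  using orthogonal unfolding monic_orthogonal_def by (metis)

lemma P_nonzero [simp]: "P n \<noteq> 0"
  using coeff_P[of n] by force

lemma P_0 [simp]: "P 0 = 1"
  using degree_P[of 0] coeff_P[of 0] by (metis degree_0_id of_nat_1 of_nat_poly one_pCons)

lemma L_P_orthogonal: "m \<noteq> n \<Longrightarrow> L (P m * P n) = 0"
  using orthogonal by (simp add: monic_orthogonal_def)

lemma degree_reduce_by_P:
  assumes "q \<noteq> 0"
  defines "r \<equiv> q - smult (lead_coeff q) (P (degree q))"
  shows "r = 0 \<or> degree r < degree q"
proof (rule eq_zero_or_degree_less)
  show "degree r \<le> degree q"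
    unfolding r_def by (intro degree_diff_le) (auto intro: order.trans[OF degree_smult_le])
qed (simp add: r_def)

lemma L_P_lower_degree: "degree q < n \<Longrightarrow> L (P n * q) = 0"
proof (induction "degree q" arbitrary: q rule: less_induct)
  case less
  show ?case
  proof (cases "q = 0")
    case False
    define r where "r = q - smult (lead_coeff q) (P (degree q))"
    have "L (P n * r) = 0"
      using degree_reduce_by_P[OF False] less unfolding r_def[symmetric] by fastforce
    moreover have "P n * q = P n * r + smult (lead_coeff q) (P n * P (degree q))"
      by (simp add: r_def algebra_simps)
    ultimately show ?thesis
      using L_P_orthogonal[of n "degree q"] less.prems by (simp add: L_add L_smult)
  qed auto
qed

definition h :: "nat \<Rightarrow> real" where "h n = (\<Prod>k=1..n. \<omega> k)"

lemma h_0 [simp]: "h 0 = 1"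
  by (simp add: h_def)

lemma h_Suc [simp]: "h (Suc n) = \<omega> (Suc n) * h n"
  by (simp add: h_def)

lemma h_pos: "h n > 0"
  unfolding h_def by (rule prod_pos) (auto intro: pos)

text \<open>Both sides of the recursion for the squared norms are values of \<open>L\<close> at
  \<open>x \<cdot> P\<^sub>n \<cdot> P\<^sub>n\<^sub>+\<^sub>1\<close>, expanded by the recurrence in one factor or the other.\<close>

lemma L_P_square: "L (P n * P n) = h n"
proof (induction n)
  case (Suc n)
  have "L ([:0, 1:] * P n * P (Suc n)) = L (P (Suc n) * P (Suc n))"
  proof (cases n)
    case 0
    then show ?thesis using recurrence_0 by simp
  next
    case (Suc m)
    then have "[:0, 1:] * P n * P (Suc n) = P (Suc n) * P (Suc n) + smult (\<omega> n) (P m * P (Suc n))"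
      using recurrence[of n] by (simp add: algebra_simps)
    then show ?thesis
      using Suc L_P_orthogonal[of m "Suc n"] by (simp add: L_add L_smult)
  qed
  moreover have "L ([:0, 1:] * P n * P (Suc n)) = \<omega> (Suc n) * L (P n * P n)"
  proof -
    have "[:0, 1:] * P n * P (Suc n) = P n * ([:0, 1:] * P (Suc n))"
      by simp
    also have "\<dots> = P n * P (Suc (Suc n)) + smult (\<omega> (Suc n)) (P n * P n)"
      using recurrence[of "Suc n"] by (simp add: algebra_simps)
    finally show ?thesis
      using L_P_orthogonal[of n "Suc (Suc n)"] by (simp add: L_add L_smult)
  qed
  ultimately show ?case
    using Suc.IH by simp
qed simp

text \<open>Strict positivity: if \<open>L (q\<^sup>2) = 0\<close>, then \<open>q\<close> vanishes almost everywhere, hence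
  \<open>L (q \<cdot> P\<^sub>d) = 0\<close> for \<open>d = degree q\<close>; but that value is the leading coefficient of \<open>q\<close>
  times the squared norm of \<open>P\<^sub>d\<close>.\<close>

lemma L_square_pos:
  assumes "q \<noteq> 0"
  shows "L (q * q) > 0"
proof (rule ccontr)
  assume "\<not> ?thesis"
  then have "L (q * q) = 0"
    using L_square_nonneg[of q] by linarith
  then have "AE x in \<mu>. poly (q * q) x = 0"
    using integral_nonneg_eq_0_iff_AE[OF has_moments_integrable_poly[OF moments], of "q * q"]
    by (simp add: has_moments_integral_poly[OF moments])
  then have "AE x in \<mu>. poly (P (degree q) * q) x = 0"
    by eventually_elim simp
  then have "integral\<^sup>L \<mu> (poly (P (degree q) * q)) = 0"
    using integral_eq_zero_AE by blast
  then have 0: "L (P (degree q) * q) = 0"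
    by (simp add: has_moments_integral_poly[OF moments])
  define r where "r = q - smult (lead_coeff q) (P (degree q))"
  have "L (P (degree q) * r) = 0"
    using degree_reduce_by_P[OF assms] L_P_lower_degree unfolding r_def[symmetric] by fastforce
  moreover have "P (degree q) * q = P (degree q) * r + smult (lead_coeff q) (P (degree q) * P (degree q))"
    by (simp add: r_def algebra_simps)
  ultimately have "L (P (degree q) * q) = lead_coeff q * h (degree q)"
    by (simp add: L_add L_smult L_P_square)
  with 0 show False
    using assms h_pos[of "degree q"] by simp
qed

section \<open>Gauss quadrature\<close>

lemma (in -) prod_linear_dvd:
  fixes p :: "real poly"
  assumes "finite A" "\<And>a. a \<in> A \<Longrightarrow> poly p a = 0"
  shows "(\<Prod>a\<in>A. [:-a, 1:]) dvd p"
  using assms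
proof (induction A rule: finite_induct)
  case (insert a A)
  then obtain q where q: "p = (\<Prod>a\<in>A. [:-a, 1:]) * q"
    by (metis dvdE insertCI)
  have "poly (\<Prod>a\<in>A. [:-a, 1:]) a \<noteq> 0"
    using insert.hyps by (auto simp: poly_prod)
  moreover have "poly p a = 0"
    using insert.prems by simp
  ultimately have "poly q a = 0"
    using q by simp
  then obtain r where "q = [:-a, 1:] * r"
    by (metis dvdE poly_eq_0_iff_dvd)
  then have "p = (\<Prod>a\<in>insert a A. [:-a, 1:]) * r"
    using q prod.insert[OF insert.hyps, of "\<lambda>a. [:-a, 1:]"] by (simp only: ac_simps)
  then show ?case
    by (rule dvdI)
qed simp

lemma (in -) degree_prod_linear [simp]: "degree (\<Prod>a\<in>A. [:-a, 1 :: real:]) = card A"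
  by (subst degree_prod_sum_eq) auto

lemma (in -) poly_no_root_imp_constant_sign:
  fixes q :: "real poly"
  assumes "\<And>x. poly q x \<noteq> 0"
  obtains s where "\<forall>x. s * poly q x > 0"
proof -
  have "poly q 0 * poly q x > 0" for x
  proof (rule ccontr)
    assume "\<not> poly q 0 * poly q x > 0"
    then have neg: "poly q 0 * poly q x < 0"
      using assms by (metis linorder_neqE_linordered_idom mult_eq_0_iff)
    then consider "x < 0" | "x > 0"
      by (metis linorder_less_linear not_square_less_zero)
    then show False
      using poly_IVT[of x 0 q] poly_IVT[of 0 x q] neg assms by cases (auto simp: mult.commute)
  qed
  then show ?thesis using that by blast
qed

text \<open>Let \<open>P\<^sub>n = N \<cdot> q\<close> with \<open>N\<close> the nodal polynomial of the real roots. A multiple root \<open>a\<close>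
  would give \<open>P\<^sub>n = (x - a)\<^sup>2 r\<close>, contradicting \<open>L (P\<^sub>n r) = 0\<close> and \<open>L ((x - a)\<^sup>2 r\<^sup>2) > 0\<close>. So \<open>q\<close> has no real
  root and keeps its sign, and \<open>L (P\<^sub>n N) = L (N\<^sup>2 q) \<noteq> 0\<close> forces \<open>N\<close> to have full degree.\<close>

lemma card_roots_P: "card {x. poly (P n) x = 0} = n"
proof (rule antisym)
  show "card {x. poly (P n) x = 0} \<le> n"
    using card_poly_roots_bound[of "P n"] by simp
  let ?A = "{x. poly (P n) x = 0}"
  let ?N = "\<Prod>a\<in>?A. [:-a, 1:]"
  have fin: "finite ?A"
    by (rule poly_roots_finite) simp
  have Nz: "?N \<noteq> 0"
    using fin by (subst prod_zero_iff) auto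
  obtain q where q: "P n = ?N * q"
    using prod_linear_dvd[OF fin, of "P n"] by (auto elim: dvdE)
  have "poly q a \<noteq> 0" for a
  proof
    assume "poly q a = 0"
    then have "poly (P n) a = 0"
      by (subst q) simp
    then have a: "a \<in> ?A" by simp
    obtain r where r: "q = [:-a, 1:] * r"
      using \<open>poly q a = 0\<close> by (metis dvdE poly_eq_0_iff_dvd)
    have "?N = [:-a, 1:] * (\<Prod>b\<in>?A - {a}. [:-b, 1:])"
      using fin a by (rule prod.remove)
    then obtain s where s: "P n = [:-a, 1:] * [:-a, 1:] * s"
      using q r by (metis (no_types, lifting) mult.assoc mult.left_commute)
    have sz: "s \<noteq> 0" using s by auto
    have "degree (P n) = 2 + degree s"
      using sz by (subst s) (simp add: degree_mult_eq del: mult_pCons_left)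
    then have "L (P n * s) = 0"
      by (intro L_P_lower_degree) simp
    moreover have "L (([:-a, 1:] * s) * ([:-a, 1:] * s)) > 0"
      using sz by (intro L_square_pos) (simp del: mult_pCons_left)
    moreover have "P n * s = ([:-a, 1:] * s) * ([:-a, 1:] * s)"
      by (subst s) (simp only: ac_simps)
    ultimately show False by simp
  qed
  then obtain s where s: "\<forall>x. s * poly q x > 0"
    by (rule poly_no_root_imp_constant_sign)
  have sq: "s \<noteq> 0" "poly q x \<noteq> 0" for x
    using spec[OF s, of x] by auto
  \<comment> \<open>By constant sign of \<open>q\<close>, a zero integral of \<open>N\<^sup>2 q\<close> forces \<open>N = 0\<close> almost everywhere.\<close>
  have "L (P n * ?N) \<noteq> 0"
  proof
    assume 0: "L (P n * ?N) = 0"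
    have "poly (smult s (P n * ?N)) x = (poly ?N x)\<^sup>2 * (s * poly q x)" for x
      by (subst q) (simp add: power2_eq_square)
    then have eq: "poly (smult s (P n * ?N)) = (\<lambda>x. (poly ?N x)\<^sup>2 * (s * poly q x))"
      by (simp add: fun_eq_iff)
    have "integral\<^sup>L \<mu> (poly (smult s (P n * ?N))) = 0"
      unfolding has_moments_integral_poly[OF moments] using 0 by (simp add: L_smult)
    moreover have "integrable \<mu> (poly (smult s (P n * ?N)))"
      by (rule has_moments_integrable_poly[OF moments])
    ultimately have "AE x in \<mu>. (poly ?N x)\<^sup>2 * (s * poly q x) = 0"
      unfolding eq by (subst (asm) integral_nonneg_eq_0_iff_AE) (auto simp: less_imp_le[OF s[rule_format]])
    then have "AE x in \<mu>. poly (?N * ?N) x = 0"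
      by eventually_elim (simp add: sq)
    then have "integral\<^sup>L \<mu> (poly (?N * ?N)) = 0"
      using integral_eq_zero_AE by blast
    then show False
      using L_square_pos[OF Nz] by (simp add: has_moments_integral_poly[OF moments])
  qed
  then show "n \<le> card ?A"
    using L_P_lower_degree[of ?N n] by fastforce
qed

definition lagrange_basis :: "real set \<Rightarrow> real \<Rightarrow> real poly" where
  "lagrange_basis A a = smult (1 / (\<Prod>b\<in>A - {a}. a - b)) (\<Prod>b\<in>A - {a}. [:-b, 1:])"

lemma poly_lagrange_basis:
  assumes "finite A" "a \<in> A" "b \<in> A"
  shows "poly (lagrange_basis A a) b = (if a = b then 1 else 0)"
proof -
  have "(\<Prod>c\<in>A - {a}. a - c) \<noteq> 0"
    using assms by (subst prod_zero_iff) auto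
  moreover have "(\<Prod>c\<in>A - {a}. b - c) = 0" if "a \<noteq> b"
    using assms that by (subst prod_zero_iff) auto
  ultimately show ?thesis
    by (auto simp: lagrange_basis_def poly_prod)
qed

lemma degree_lagrange_basis:
  assumes "finite A" "a \<in> A"
  shows "degree (lagrange_basis A a) \<le> card A - 1"
  using assms unfolding lagrange_basis_def
  by (intro order.trans[OF degree_smult_le]) simp

lemma lagrange_interpolation:
  assumes "finite A" "degree p < card A"
  shows "p = (\<Sum>a\<in>A. smult (poly p a) (lagrange_basis A a))"
proof (rule poly_eqI_degree[of A])
  fix x assume "x \<in> A"
  then have "(\<Sum>a\<in>A. poly p a * poly (lagrange_basis A a) x) = (\<Sum>a\<in>A. if a = x then poly p a else 0)"
    using assms by (intro sum.cong) (auto simp: poly_lagrange_basis)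
  then show "poly p x = poly (\<Sum>a\<in>A. smult (poly p a) (lagrange_basis A a)) x"
    using assms \<open>x \<in> A\<close> by (simp add: poly_sum)
next
  have "degree (\<Sum>a\<in>A. smult (poly p a) (lagrange_basis A a)) \<le> card A - 1"
    using assms
    by (intro degree_sum_le order.trans[OF degree_smult_le] degree_lagrange_basis) auto
  then show "degree (\<Sum>a\<in>A. smult (poly p a) (lagrange_basis A a)) < card A"
    using assms by linarith
qed (use assms in auto)

lemma L_eq_L_mod_P:
  assumes "degree p < 2 * n"
  shows "L p = L (p mod P n)"
proof -
  have "p = P n * (p div P n) + p mod P n"
    by simp
  moreover have "L (P n * (p div P n)) = 0"
  proof (cases "p div P n = 0")
    case False
    then have "degree (P n * (p div P n)) = n + degree (p div P n)"
      by (simp add: degree_mult_eq)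
    moreover have "degree (P n * (p div P n)) \<le> degree p"
    proof (rule ccontr)
      assume "\<not> ?thesis"
      then have lt: "degree p < degree (P n * (p div P n))"
        by simp
      then have "degree (p - P n * (p div P n)) = degree (P n * (p div P n))"
        by (metis degree_add_eq_right degree_minus uminus_add_conv_diff add.commute)
      moreover have "p - P n * (p div P n) = p mod P n"
        by (simp add: minus_mult_div_eq_mod)
      moreover have "p mod P n = 0 \<or> degree (p mod P n) < n"
        using degree_mod_less[of "P n" p] by simp
      ultimately show False
        using \<open>degree (P n * (p div P n)) = n + degree (p div P n)\<close> lt by auto
    qed
    ultimately show ?thesis
      using assms by (intro L_P_lower_degree) linarith
  qed simp
  ultimately show ?thesis
    by (metis L_add add_0)
qed

end

lemma borel_measurable_poly [measurable]: "poly (p :: real poly) \<in> borel_measurable borel"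
  by (intro borel_measurable_continuous_onI continuous_on_poly continuous_on_id)

context jacobi_moment_problem
begin

text \<open>Integration against the weights \<open>L (lagrange_basis A a)\<close> is exact below degree \<open>n\<close> by
  interpolation, and below degree \<open>2n\<close> by division by \<open>P\<^sub>n\<close>. Exactness for the squares of the
  basis polynomials makes the weights nonnegative.\<close>

lemma gauss_quadrature_formula:
  fixes n
  defines "A \<equiv> {x. poly (P n) x = 0}"
  assumes "degree p < 2 * n"
  shows "L p = (\<Sum>a\<in>A. L (lagrange_basis A a) * poly p a)"
proof -
  let ?r = "p mod P n"
  have fin: "finite A"
    unfolding A_def by (rule poly_roots_finite) simp
  have card: "card A = n"
    by (simp add: A_def card_roots_P)
  have "degree ?r < card A"
    unfolding card using degree_mod_less[of "P n" p] assms(2) by auto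
  then have "L ?r = L (\<Sum>a\<in>A. smult (poly ?r a) (lagrange_basis A a))"
    using lagrange_interpolation[OF fin] by presburger
  also have "\<dots> = (\<Sum>a\<in>A. L (lagrange_basis A a) * poly ?r a)"
    by (simp add: L_sum L_smult mult.commute)
  also have "\<dots> = (\<Sum>a\<in>A. L (lagrange_basis A a) * poly p a)"
  proof (intro sum.cong refl)
    fix a assume "a \<in> A"
    then have "poly ?r a = poly (P n * (p div P n) + ?r) a"
      by (simp only: poly_add poly_mult) (simp add: A_def)
    then show "L (lagrange_basis A a) * poly ?r a = L (lagrange_basis A a) * poly p a"
      by simp
  qed
  finally show ?thesis
    using L_eq_L_mod_P[OF assms(2)] by simp
qed

lemma gauss_weight_nonneg:
  fixes n
  defines "A \<equiv> {x. poly (P n) x = 0}"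
  assumes "a \<in> A"
  shows "L (lagrange_basis A a) \<ge> 0"
proof -
  let ?l = "lagrange_basis A a"
  have fin: "finite A"
    unfolding A_def by (rule poly_roots_finite) simp
  have card: "card A = n"
    by (simp add: A_def card_roots_P)
  then have "n > 0"
    using assms(2) fin by (metis card_gt_0_iff empty_iff)
  then have "degree (?l * ?l) < 2 * n"
    using degree_lagrange_basis[OF fin assms(2)] degree_mult_le[of ?l ?l] card by linarith
  then have "L (?l * ?l) = (\<Sum>b\<in>A. L (lagrange_basis A b) * poly (?l * ?l) b)"
    unfolding A_def by (rule gauss_quadrature_formula)
  also have "\<dots> = (\<Sum>b\<in>A. if a = b then L (lagrange_basis A b) else 0)"
    using fin assms(2) by (intro sum.cong) (auto simp: poly_lagrange_basis)
  also have "\<dots> = L ?l"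
    using fin assms(2) by simp
  finally show ?thesis
    using L_square_nonneg[of ?l] by simp
qed

lemma gauss_measure_exists:
  assumes "n \<ge> 1"
  shows "\<exists>\<nu>. real_distribution \<nu> \<and> (\<forall>g :: real \<Rightarrow> real. g \<in> borel_measurable borel \<longrightarrow> integrable \<nu> g) \<and>
    (\<forall>p. degree p < 2 * n \<longrightarrow> integral\<^sup>L \<nu> (poly p) = L p) \<and> (AE x in \<nu>. poly (P n) x = 0)"
proof -
  define A where "A = {x. poly (P n) x = 0}"
  define wt where "wt x = (if x \<in> A then L (lagrange_basis A x) else 0)" for x
  have fin: "finite A"
    unfolding A_def by (rule poly_roots_finite) simp
  have nonneg: "wt x \<ge> 0" for x
    using gauss_weight_nonneg[of x n] by (simp add: wt_def A_def)
  have quadrature: "L p = (\<Sum>a\<in>A. wt a * poly p a)" if "degree p < 2 * n" for p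
    using gauss_quadrature_formula[OF that] by (simp add: wt_def A_def)
  have "(\<Sum>a\<in>A. wt a) = 1"
    using quadrature[of 1] assms by simp
  moreover have "(\<integral>\<^sup>+x. ennreal (wt x) \<partial>count_space UNIV) = (\<Sum>a\<in>A. ennreal (wt a))"
    using fin by (intro nn_integral_count_space') (auto simp: wt_def)
  ultimately have total: "(\<integral>\<^sup>+x. ennreal (wt x) \<partial>count_space UNIV) = 1"
    using nonneg by (simp add: sum_ennreal)
  define p where "p = embed_pmf wt"
  have pmf: "pmf p x = wt x" for x
    unfolding p_def by (rule pmf_embed_pmf[OF nonneg total])
  have sub: "set_pmf p \<subseteq> A"
    by (auto simp: set_pmf_iff pmf wt_def split: if_splits)
  define \<nu> where "\<nu> = distr (measure_pmf p) borel (\<lambda>x. x)"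
  have "real_distribution \<nu>"
    unfolding \<nu>_def by (rule prob_space.real_distribution_distr) (auto intro: measure_pmf.prob_space_axioms)
  moreover have "integrable \<nu> g" if "g \<in> borel_measurable borel" for g :: "real \<Rightarrow> real"
    unfolding \<nu>_def using that sub fin
    by (subst integrable_distr_eq) (auto intro: integrable_measure_pmf_finite finite_subset)
  moreover have "integral\<^sup>L \<nu> (poly q) = L q" if "degree q < 2 * n" for q
  proof -
    have "integral\<^sup>L \<nu> (poly q) = (\<integral>x. poly q x \<partial>measure_pmf p)"
      unfolding \<nu>_def by (subst integral_distr) auto
    also have "\<dots> = (\<Sum>a\<in>A. poly q a * pmf p a)"
      using sub by (intro integral_measure_pmf_real fin) auto
    finally show ?thesis
      using quadrature[OF that] by (simp add: pmf mult.commute)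
  qed
  moreover have "AE x in \<nu>. poly (P n) x = 0"
    unfolding \<nu>_def
  proof (subst AE_distr_iff)
    show "AE x in measure_pmf p. poly (P n) x = 0"
      using sub by (auto simp: AE_measure_pmf_iff A_def)
  qed auto
  ultimately show ?thesis
    by blast
qed

section \<open>Values at the imaginary unit\<close>

text \<open>Shifting the index of \<open>B\<close> makes \<open>P\<^sub>n(i) = i\<^sup>n den n\<close>.  The fractions \<open>num n / den n\<close>
  are the convergents of \<open>1 / (1 + \<omega>\<^sub>1 / (1 + \<omega>\<^sub>2 / \<dots>))\<close>, the formal value of the integral of
  \<open>1 / (1 + x\<^sup>2)\<close>.\<close>

definition den :: "nat \<Rightarrow> real" where
  "den n = (case n of 0 \<Rightarrow> 1 | Suc m \<Rightarrow> B_seq \<omega> m)"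

fun num :: "nat \<Rightarrow> real" where
  "num 0 = 0"
| "num (Suc 0) = 1"
| "num (Suc (Suc n)) = num (Suc n) + \<omega> (Suc n) * num n"

lemma den_simps [simp]:
  "den 0 = 1" "den (Suc 0) = 1" "den (Suc (Suc n)) = den (Suc n) + \<omega> (Suc n) * den n"
proof -
  show "den (Suc (Suc n)) = den (Suc n) + \<omega> (Suc n) * den n"
    by (cases n) (simp_all add: den_def)
qed (simp_all add: den_def)

lemma den_pos: "den n > 0"
proof (induction n rule: num.induct)
  case (3 n)
  then show ?case
    using pos[of "Suc n"] by (simp add: add_pos_pos)
qed auto

lemma casoratian: "num (Suc n) * den n - num n * den (Suc n) = (-1) ^ n * h n"
proof (induction n)
  case (Suc n)
  have "num (Suc (Suc n)) * den (Suc n) - num (Suc n) * den (Suc (Suc n)) =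
    - \<omega> (Suc n) * (num (Suc n) * den n - num n * den (Suc n))"
    by (simp add: algebra_simps)
  also have "\<dots> = (-1) ^ Suc n * h (Suc n)"
    using Suc by (simp add: algebra_simps)
  finally show ?case .
qed simp

text \<open>The sum of \<open>\<bar>p\<^sub>k(i)\<bar>\<^sup>2\<close> over the orthonormal polynomials \<open>p\<^sub>k = P\<^sub>k / sqrt (h k)\<close>.\<close>

definition kernel :: "nat \<Rightarrow> real" where
  "kernel n = (\<Sum>k\<le>n. (den k)\<^sup>2 / h k)"

text \<open>The Christoffel--Darboux formula on the diagonal at \<open>i\<close>.\<close>

lemma kernel_closed_form: "kernel n = den n * den (Suc n) / h n"
proof (induction n)
  case (Suc n)
  have nz: "\<omega> (Suc n) \<noteq> 0" "h n \<noteq> 0"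
    using pos[of "Suc n"] h_pos[of n] by auto
  have "kernel (Suc n) = den n * den (Suc n) / h n + (den (Suc n))\<^sup>2 / h (Suc n)"
    using Suc by (simp add: kernel_def)
  also have "\<dots> = den (Suc n) * den (Suc (Suc n)) / h (Suc n)"
    using nz by (simp add: field_simps power2_eq_square)
  finally show ?case .
qed (simp add: kernel_def)

lemma kernel_pos: "kernel n > 0"
  using den_pos h_pos by (simp add: kernel_closed_form)

lemma kernel_mono: "m \<le> n \<Longrightarrow> kernel m \<le> kernel n"
  unfolding kernel_def by (rule sum_mono2) (auto simp: h_pos less_imp_le)

lemma convergent_difference:
  "num (Suc n) / den (Suc n) - num n / den n = (-1) ^ n / kernel n"
  using den_pos[of n] den_pos[of "Suc n"] casoratian[of n]
  by (simp add: kernel_closed_form field_simps)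

text \<open>The left-hand side is a term of the series in (SC).\<close>

lemma kernel_ratio: "den (Suc n) / den (Suc (Suc n)) = (kernel (Suc n) - kernel n) / kernel (Suc n)"
proof -
  have "kernel (Suc n) - kernel n = (den (Suc n))\<^sup>2 / h (Suc n)"
    by (simp add: kernel_def)
  then show ?thesis
    using den_pos[of "Suc n"] den_pos[of "Suc (Suc n)"] h_pos[of "Suc n"]
    unfolding kernel_closed_form[of "Suc n"]
    by (simp add: divide_simps power2_eq_square del: h_Suc den_simps)
qed

end

text \<open>Relative increments are at most the increments divided by \<open>s 0\<close>, and those telescope.
  Conversely, if the relative increments from \<open>N\<close> on add up to less than \<open>1/2\<close>, then replacing all
  denominators by the last and largest one gives \<open>(s n - s N) / s n < 1/2\<close>.\<close>

lemma summable_relative_increments_iff_bounded: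
  fixes s :: "nat \<Rightarrow> real"
  assumes pos: "\<And>n. s n > 0" and mono: "\<And>n. s n \<le> s (Suc n)"
  shows "summable (\<lambda>n. (s (Suc n) - s n) / s (Suc n)) \<longleftrightarrow> (\<exists>C. \<forall>n. s n \<le> C)"
proof
  have le: "s m \<le> s n" if "m \<le> n" for m n
    using mono that by (rule lift_Suc_mono_le)
  assume "\<exists>C. \<forall>n. s n \<le> C"
  then obtain C where C: "\<And>n. s n \<le> C" by blast
  show "summable (\<lambda>n. (s (Suc n) - s n) / s (Suc n))"
  proof (rule summable_comparison_test')
    have "convergent s"
      using le C by (intro Bseq_mono_convergent BseqI'[of _ C]) (auto simp: less_imp_le pos)
    then have "summable (\<lambda>n. s (Suc n) - s n)"
      using telescope_summable by (auto simp: convergent_def)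
    then show "summable (\<lambda>n. (s (Suc n) - s n) / s 0)"
      by (rule summable_divide)
    show "norm ((s (Suc n) - s n) / s (Suc n)) \<le> (s (Suc n) - s n) / s 0" if "n \<ge> 0" for n
      using pos[of 0] pos[of "Suc n"] mono[of n] le[of 0 "Suc n"]
      by (simp add: frac_le)
  qed
next
  have le: "s m \<le> s n" if "m \<le> n" for m n
    using mono that by (rule lift_Suc_mono_le)
  assume "summable (\<lambda>n. (s (Suc n) - s n) / s (Suc n))"
  then obtain N where N: "\<And>m n. m \<ge> N \<Longrightarrow> norm (\<Sum>k=m..<n. (s (Suc k) - s k) / s (Suc k)) < 1/2"
    unfolding summable_Cauchy by (metis half_gt_zero_iff zero_less_one)
  have "s n \<le> 2 * s N" for n
  proof (cases "n \<ge> N")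
    case True
    have "(s n - s N) / s n = (\<Sum>k=N..<n. (s (Suc k) - s k) / s n)"
      using True by (simp add: sum_Suc_diff' flip: sum_divide_distrib)
    also have "\<dots> \<le> (\<Sum>k=N..<n. (s (Suc k) - s k) / s (Suc k))"
      using pos mono le by (intro sum_mono divide_left_mono) auto
    also have "\<dots> < 1/2"
      using N[of N n] by simp
    finally show ?thesis
      using pos[of n] by (simp add: field_simps)
  next
    case False
    then show ?thesis
      using le[of n N] pos[of N] by simp
  qed
  then show "\<exists>C. \<forall>n. s n \<le> C" by blast
qed

context jacobi_moment_problem
begin

lemma property_SC_iff_kernel_bounded: "property_SC \<omega> \<longleftrightarrow> (\<exists>C. \<forall>n. kernel n \<le> C)"
proof -
  have "property_SC \<omega> \<longleftrightarrow> summable (\<lambda>n. (kernel (Suc n) - kernel n) / kernel (Suc n))"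
    unfolding property_SC_def kernel_ratio[symmetric] by (simp add: den_def)
  also have "\<dots> \<longleftrightarrow> (\<exists>C. \<forall>n. kernel n \<le> C)"
    by (intro summable_relative_increments_iff_bounded kernel_pos kernel_mono) simp
  finally show ?thesis .
qed

text \<open>\<open>D\<close> is \<open>P\<close> up to signs; \<open>W\<close> has a further factor \<open>- x\<close> at odd indices. Thus \<open>W\<^sub>n(i) = den n\<close>,
  and modulo \<open>1 + x\<^sup>2\<close> the polynomials \<open>W\<^sub>n\<close> satisfy the recursion of \<open>den\<close>.\<close>

definition D :: "nat \<Rightarrow> real poly" where
  "D n = smult ((-1) ^ (n div 2)) (P n)"

definition W :: "nat \<Rightarrow> real poly" where
  "W n = (if even n then D n else - [:0, 1:] * D n)"

lemma W_0: "W 0 = 1"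
  by (simp add: W_def D_def)

lemma W_1: "W (Suc 0) = 1 - [:1, 0, 1:]"
proof -
  have "P (Suc 0) = [:0, 1:]"
    using recurrence_0 by simp
  then show ?thesis
    by (simp add: W_def D_def one_pCons)
qed

text \<open>The last term comes from replacing \<open>x\<^sup>2\<close> by \<open>- 1\<close>: the step from the even index \<open>n + 1\<close> to the
  next odd one multiplies by \<open>x\<close> both in the recurrence and in the definition of \<open>W\<close>.\<close>

lemma W_rec:
  "W (Suc (Suc n)) = W (Suc n) + smult (\<omega> (Suc n)) (W n) - (if odd n then [:1, 0, 1:] * D (Suc n) else 0)"
proof -
  have "P (Suc (Suc n)) = [:0, 1:] * P (Suc n) - smult (\<omega> (Suc n)) (P n)"
    using recurrence[of "Suc n"] by simp
  then have P: "poly (P (Suc (Suc n))) x = x * poly (P (Suc n)) x - \<omega> (Suc n) * poly (P n) x" for x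
    by simp
  show ?thesis
  proof (cases "even n")
    case True
    then show ?thesis
      by (simp add: poly_eq_poly_eq_iff[symmetric] fun_eq_iff W_def D_def P algebra_simps)
  next
    case False
    then show ?thesis
      by (simp add: poly_eq_poly_eq_iff[symmetric] fun_eq_iff W_def D_def P algebra_simps)
  qed
qed

end

lemma one_plus_square_pos: "0 < 1 + (x :: real)\<^sup>2"
  by (simp add: add_pos_nonneg)

context jacobi_moment_problem
begin

text \<open>Dividing the recursion of \<open>W\<close> by \<open>1 + x\<^sup>2\<close> and integrating gives the recursion shared by \<open>den\<close> and
  \<open>num\<close>: the multiples of \<open>1 + x\<^sup>2\<close> in it contribute integrals of \<open>P\<^sub>j\<close> with \<open>0 < j < n\<close>, which vanish.
  The initial values account for the combination on the right-hand side.\<close>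

lemma integral_W_over_1_plus_square:
  assumes "real_distribution \<nu>"
    and int: "\<And>g :: real \<Rightarrow> real. g \<in> borel_measurable borel \<Longrightarrow> integrable \<nu> g"
    and exact: "\<And>p. degree p < 2 * n \<Longrightarrow> integral\<^sup>L \<nu> (poly p) = L p"
    and "k \<le> n"
  shows "(\<integral>x. poly (W k) x / (1 + x\<^sup>2) \<partial>\<nu>) = den k * (\<integral>x. 1 / (1 + x\<^sup>2) \<partial>\<nu>) - num k"
  using \<open>k \<le> n\<close>
proof (induction k rule: num.induct)
  case 1
  then show ?case by (simp add: W_0)
next
  case 2
  interpret real_distribution \<nu> by fact
  have "poly (W (Suc 0)) x / (1 + x\<^sup>2) = 1 / (1 + x\<^sup>2) - 1" for x
    using one_plus_square_pos[of x] by (simp add: W_1 field_simps power2_eq_square)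
  moreover have "(\<integral>x. 1 / (1 + x\<^sup>2) - 1 \<partial>\<nu>) = (\<integral>x. 1 / (1 + x\<^sup>2) \<partial>\<nu>) - 1"
    by (subst Bochner_Integration.integral_diff) (use prob_space in \<open>auto intro!: int\<close>)
  ultimately show ?case by simp
next
  case (3 k)
  let ?d = "if odd k then D (Suc k) else 0"
  have "integral\<^sup>L \<nu> (poly (D (Suc k))) = L (D (Suc k))"
    using 3(3) by (intro exact) (simp add: D_def)
  moreover have "L (D (Suc k)) = 0"
    using L_P_lower_degree[of 1 "Suc k"] by (simp add: D_def L_smult)
  moreover have "poly (0 :: real poly) = (\<lambda>x. 0)"
    by (simp add: fun_eq_iff)
  ultimately have d: "integral\<^sup>L \<nu> (poly ?d) = 0"
    by simp
  have W: "poly (W (Suc (Suc k))) x =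
      poly (W (Suc k)) x + \<omega> (Suc k) * poly (W k) x - (1 + x\<^sup>2) * poly ?d x" for x
    by (simp add: W_rec power2_eq_square algebra_simps)
  have eq: "poly (W (Suc (Suc k))) x / (1 + x\<^sup>2) =
      (poly (W (Suc k)) x / (1 + x\<^sup>2) + \<omega> (Suc k) * (poly (W k) x / (1 + x\<^sup>2))) - poly ?d x" for x
    using one_plus_square_pos[of x] unfolding W by (simp add: diff_divide_distrib add_divide_distrib)
  have [simp]: "integrable \<nu> (\<lambda>x. poly p x / (1 + x\<^sup>2))" "integrable \<nu> (poly p)" for p
    by (auto intro!: int)
  have linear: "(\<integral>x. f x + c * g x - poly p x \<partial>\<nu>) =
      integral\<^sup>L \<nu> f + c * integral\<^sup>L \<nu> g - integral\<^sup>L \<nu> (poly p)"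
    if "integrable \<nu> f" "integrable \<nu> g" for f g c p
    using that by simp
  have IH: "(\<integral>x. poly (W j) x / (1 + x\<^sup>2) \<partial>\<nu>) = den j * (\<integral>x. 1 / (1 + x\<^sup>2) \<partial>\<nu>) - num j"
    if "j = k \<or> j = Suc k" for j
    using that 3 by auto
  show ?case
    unfolding eq by (subst linear) (simp_all add: IH d algebra_simps)
qed

text \<open>At the nodes \<open>W\<^sub>n\<close> vanishes, so the left-hand side of the previous identity is \<open>0\<close> for \<open>k = n\<close>.\<close>

lemma gauss_measure_convergent:
  assumes "n \<ge> 1"
  obtains \<nu> where "real_distribution \<nu>"
    and "\<And>p. integrable \<nu> (poly p)"
    and "\<And>p. degree p < 2 * n \<Longrightarrow> integral\<^sup>L \<nu> (poly p) = L p"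
    and "(\<integral>x. 1 / (1 + x\<^sup>2) \<partial>\<nu>) = num n / den n"
proof -
  obtain \<nu> where \<nu>: "real_distribution \<nu>"
    and int: "\<And>g :: real \<Rightarrow> real. g \<in> borel_measurable borel \<Longrightarrow> integrable \<nu> g"
    and exact: "\<And>p. degree p < 2 * n \<Longrightarrow> integral\<^sup>L \<nu> (poly p) = L p"
    and nodes: "AE x in \<nu>. poly (P n) x = 0"
    using gauss_measure_exists[OF assms] by auto
  have "AE x in \<nu>. poly (W n) x / (1 + x\<^sup>2) = 0"
    using nodes by eventually_elim (simp add: W_def D_def)
  then have "(\<integral>x. poly (W n) x / (1 + x\<^sup>2) \<partial>\<nu>) = 0"
    by (rule integral_eq_zero_AE)
  then have "(\<integral>x. 1 / (1 + x\<^sup>2) \<partial>\<nu>) = num n / den n"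
    using integral_W_over_1_plus_square[OF \<nu> int exact order_refl] den_pos[of n]
    by (simp add: field_simps)
  then show ?thesis
    by (intro that[OF \<nu> int exact]) auto
qed

end

section \<open>Weak limits of measures with prescribed moments\<close>

lemma truncation_error:
  fixes f :: "real \<Rightarrow> real"
  assumes "real_distribution N" "integrable N f" "integrable N (\<lambda>x. (f x)\<^sup>2)" "c > 0"
  shows "\<bar>integral\<^sup>L N f - (\<integral>x. max (-c) (min c (f x)) \<partial>N)\<bar> \<le> (\<integral>x. (f x)\<^sup>2 \<partial>N) / c"
proof -
  interpret real_distribution N by fact
  have [measurable]: "f \<in> borel_measurable N"
    using assms(2) by simp
  have int: "integrable N (\<lambda>x. max (-c) (min c (f x)))"
    by (rule integrable_const_bound[of _ c]) (use assms(4) in auto)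
  have pointwise: "\<bar>y - max (-c) (min c y)\<bar> \<le> y\<^sup>2 / c" for y
  proof -
    have "c * \<bar>y - max (-c) (min c y)\<bar> \<le> \<bar>y\<bar> * \<bar>y\<bar>" if "\<bar>y\<bar> > c"
      using that assms(4) by (intro mult_mono) auto
    moreover have "y - max (-c) (min c y) = 0" if "\<bar>y\<bar> \<le> c"
      using that by auto
    ultimately show ?thesis
      using assms(4) by (cases "\<bar>y\<bar> > c") (auto simp: field_simps power2_eq_square)
  qed
  have "\<bar>integral\<^sup>L N f - (\<integral>x. max (-c) (min c (f x)) \<partial>N)\<bar> = \<bar>\<integral>x. f x - max (-c) (min c (f x)) \<partial>N\<bar>"
    using assms(2) int by simp
  also have "\<dots> \<le> (\<integral>x. \<bar>f x - max (-c) (min c (f x))\<bar> \<partial>N)"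
    by (rule integral_abs_bound)
  also have "\<dots> \<le> (\<integral>x. (f x)\<^sup>2 / c \<partial>N)"
    using assms int by (intro integral_mono pointwise) auto
  finally show ?thesis by simp
qed

text \<open>Weak convergence controls integrals of bounded continuous functions only.  Truncating \<open>x\<^sup>k\<close> at level \<open>c\<close>
  changes its integrals by at most \<open>M\<^sub>2\<^sub>k / c\<close>, uniformly along the sequence and in the limit.\<close>

lemma has_moments_weak_limit:
  assumes dist: "\<And>n. real_distribution (\<nu> n)" "real_distribution \<nu>'"
    and conv: "weak_conv_m \<nu> \<nu>'"
    and mom: "\<And>k. \<forall>\<^sub>F n in sequentially. has_bochner_integral (\<nu> n) (\<lambda>x. x ^ k) (M k)"
  shows "has_moments \<nu>' M"
proof -
  interpret N': real_distribution \<nu>' by fact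
  have limit: "(\<lambda>n. integral\<^sup>L (\<nu> n) f) \<longlonglongrightarrow> integral\<^sup>L \<nu>' f"
    if "\<And>x. isCont f x" "\<And>x. \<bar>f x\<bar> \<le> B" for f :: "real \<Rightarrow> real" and B
    using weak_conv_imp_integral_bdd_continuous_conv[OF dist conv, of f B] that by simp
  \<comment> \<open>Fatou-type step: truncating \<open>x\<^bsup>2k\<^esup>\<close> from above gives bounded continuous functions.\<close>
  have even: "integrable \<nu>' (\<lambda>x. x ^ (2 * k))" "(\<integral>x. x ^ (2 * k) \<partial>\<nu>') \<le> M (2 * k)" for k
  proof -
    define f where "f i x = min (real i) (x ^ (2 * k))" for i and x :: real
    have f_bound: "\<bar>f i x\<bar> \<le> real i" for i x
      by (simp add: f_def power_mult)
    have cont: "isCont (f i) x" for i x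
      unfolding f_def by (intro continuous_intros)
    have [measurable]: "f i \<in> borel_measurable borel" for i
      unfolding f_def by measurable
    have int: "integrable \<nu>' (f i)" for i
      by (rule N'.integrable_const_bound[of _ "real i"]) (use f_bound in auto)
    have le: "integral\<^sup>L \<nu>' (f i) \<le> M (2 * k)" for i
    proof (rule tendsto_upperbound[OF limit[OF cont f_bound]])
      show "\<forall>\<^sub>F n in sequentially. integral\<^sup>L (\<nu> n) (f i) \<le> M (2 * k)"
        using mom[of "2 * k"]
      proof eventually_elim
        case (elim n)
        interpret N: real_distribution "\<nu> n" by (rule dist)
        have "integral\<^sup>L (\<nu> n) (f i) \<le> (\<integral>x. x ^ (2 * k) \<partial>\<nu> n)"
        proof (rule integral_mono)
          show "integrable (\<nu> n) (f i)"
            by (rule N.integrable_const_bound[of _ "real i"]) (use f_bound in auto)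
        qed (use elim in \<open>auto simp: f_def has_bochner_integral_iff\<close>)
        then show ?case
          using elim by (simp add: has_bochner_integral_iff)
      qed
    qed simp
    have mono: "mono (\<lambda>i. f i x)" for x
      by (auto simp: mono_def f_def min_le_iff_disj)
    have "incseq (\<lambda>i. integral\<^sup>L \<nu>' (f i))"
      using mono int by (auto simp: incseq_def mono_def intro!: integral_mono)
    then obtain c where c: "(\<lambda>i. integral\<^sup>L \<nu>' (f i)) \<longlonglongrightarrow> c"
      using le incseq_convergent[of "\<lambda>i. integral\<^sup>L \<nu>' (f i)" "M (2 * k)"] by metis
    have ptw: "(\<lambda>i. f i x) \<longlonglongrightarrow> x ^ (2 * k)" for x
    proof (rule tendsto_eventually)
      show "\<forall>\<^sub>F i in sequentially. f i x = x ^ (2 * k)"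
        using eventually_ge_at_top[of "nat \<lceil>x ^ (2 * k)\<rceil>"]
      proof eventually_elim
        case (elim i)
        then have "x ^ (2 * k) \<le> real i"
          using real_nat_ceiling_ge[of "x ^ (2 * k)"] by linarith
        then show ?case by (simp add: f_def)
      qed
    qed
    show "integrable \<nu>' (\<lambda>x. x ^ (2 * k))"
      by (rule integrable_monotone_convergence[OF int _ _ c]) (use mono ptw in auto)
    have "(\<integral>x. x ^ (2 * k) \<partial>\<nu>') = c"
      by (rule integral_monotone_convergence[OF int _ _ c]) (use mono ptw in auto)
    then show "(\<integral>x. x ^ (2 * k) \<partial>\<nu>') \<le> M (2 * k)"
      using c le by (auto intro: LIMSEQ_le_const2)
  qed
  have square: "(x ^ k)\<^sup>2 = x ^ (2 * k)" for x :: real and k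
    by (simp add: power_mult[symmetric] mult.commute)
  have int: "integrable \<nu>' (\<lambda>x. x ^ k)" for k
  proof (rule Bochner_Integration.integrable_bound)
    show "integrable \<nu>' (\<lambda>x. 1 + x ^ (2 * k))"
      using even(1)[of k] by simp
    have "\<bar>y\<bar> \<le> 1 + y\<^sup>2" for y :: real
      using zero_le_power2[of "\<bar>y\<bar> - 1"] by (simp add: power2_diff algebra_simps)
    then show "AE x in \<nu>'. norm (x ^ k) \<le> norm (1 + x ^ (2 * k))"
      by (simp add: square[symmetric])
  qed simp
  have "(\<integral>x. x ^ k \<partial>\<nu>') = M k" for k
  proof -
    have bound: "\<bar>(\<integral>x. x ^ k \<partial>\<nu>') - M k\<bar> \<le> 2 * M (2 * k) / c" if "c > 0" for c
    proof -
      define g where "g = (\<lambda>x :: real. max (-c) (min c (x ^ k)))"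
      have "\<bar>(\<integral>x. x ^ k \<partial>\<nu>') - integral\<^sup>L \<nu>' g\<bar> \<le> (\<integral>x. x ^ (2 * k) \<partial>\<nu>') / c"
        using truncation_error[of \<nu>' "\<lambda>x. x ^ k" c] int even that dist by (simp add: square g_def)
      also have "\<dots> \<le> M (2 * k) / c"
        using even that by (simp add: divide_right_mono)
      finally have 1: "\<bar>(\<integral>x. x ^ k \<partial>\<nu>') - integral\<^sup>L \<nu>' g\<bar> \<le> M (2 * k) / c" .
      have "(\<lambda>n. \<bar>M k - integral\<^sup>L (\<nu> n) g\<bar>) \<longlonglongrightarrow> \<bar>M k - integral\<^sup>L \<nu>' g\<bar>"
      proof (intro tendsto_intros limit)
        show "isCont g x" for x
          unfolding g_def by (intro continuous_intros)
        show "\<bar>g x\<bar> \<le> c" for x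
          using that by (auto simp: g_def)
      qed
      moreover have "\<forall>\<^sub>F n in sequentially. \<bar>M k - integral\<^sup>L (\<nu> n) g\<bar> \<le> M (2 * k) / c"
        using mom[of k] mom[of "2 * k"]
      proof eventually_elim
        case (elim n)
        then show ?case
          using truncation_error[of "\<nu> n" "\<lambda>x. x ^ k" c] that dist
          by (simp add: square g_def has_bochner_integral_iff)
      qed
      ultimately have "\<bar>M k - integral\<^sup>L \<nu>' g\<bar> \<le> M (2 * k) / c"
        by (rule tendsto_upperbound) simp
      with 1 show ?thesis by linarith
    qed
    have "(\<lambda>n. 2 * M (2 * k) / real (Suc n)) \<longlonglongrightarrow> 0"
      by (rule LIMSEQ_Suc[OF lim_const_over_n])
    then have "\<bar>(\<integral>x. x ^ k \<partial>\<nu>') - M k\<bar> \<le> 0"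
      by (rule tendsto_lowerbound) (auto intro!: always_eventually bound)
    then show ?thesis by simp
  qed
  then show ?thesis
    using int dist by (simp add: has_moments_def has_bochner_integral_iff)
qed

text \<open>Chebyshev's inequality.\<close>

lemma tight_if_second_moments_bounded:
  assumes dist: "\<And>n. real_distribution (\<nu> n)"
    and int: "\<And>n. integrable (\<nu> n) (\<lambda>x. x\<^sup>2)"
    and bound: "\<And>n. (\<integral>x. x\<^sup>2 \<partial>\<nu> n) \<le> C"
  shows "tight \<nu>"
  unfolding tight_def
proof (intro conjI allI impI)
  fix \<epsilon> :: real assume "\<epsilon> > 0"
  define c where "c = sqrt ((\<bar>C\<bar> + 1) / \<epsilon>)"
  have "c > 0"
    using \<open>\<epsilon> > 0\<close> by (simp add: c_def)
  have c2: "c\<^sup>2 = (\<bar>C\<bar> + 1) / \<epsilon>"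
    using \<open>\<epsilon> > 0\<close> by (simp add: c_def)
  have "measure (\<nu> n) {-c<..c} > 1 - \<epsilon>" for n
  proof -
    interpret real_distribution "\<nu> n" by (rule dist)
    have "measure (\<nu> n) (- {-c<..c}) = (\<integral>x. indicator (- {-c<..c}) x \<partial>\<nu> n)"
      by simp
    also have "\<dots> \<le> (\<integral>x. x\<^sup>2 / c\<^sup>2 \<partial>\<nu> n)"
    proof (rule integral_mono)
      show "indicat_real (- {-c<..c}) x \<le> x\<^sup>2 / c\<^sup>2" for x
      proof (cases "x \<in> {-c<..c}")
        case False
        then have "\<bar>c\<bar> \<le> \<bar>x\<bar>" using \<open>c > 0\<close> by auto
        then have "c\<^sup>2 \<le> x\<^sup>2" by (simp add: abs_le_square_iff)
        then show ?thesis using False \<open>c > 0\<close> by simp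
      qed simp
      show "integrable (\<nu> n) (indicat_real (- {-c<..c}))"
        by (rule integrable_const_bound[of _ 1]) auto
    qed (use int[of n] in auto)
    also have "\<dots> \<le> C / c\<^sup>2"
      using bound[of n] by (simp add: divide_right_mono)
    also have "\<dots> < \<epsilon>"
      using \<open>\<epsilon> > 0\<close> mult_strict_right_mono[of C "\<bar>C\<bar> + 1" \<epsilon>]
      by (simp add: c2 field_simps)
    finally show ?thesis
      using prob_compl[of "{-c<..c}"] by (simp add: Compl_eq_Diff_UNIV)
  qed
  then show "\<exists>a b. a < b \<and> (\<forall>n. 1 - \<epsilon> < measure (\<nu> n) {a<..b})"
    using \<open>c > 0\<close> by (intro exI[of _ "-c"] exI[of _ c]) auto
qed (rule dist)

context jacobi_moment_problem
begin

text \<open>Two limit points of Gauss measures, one of them along the successors of the indices of the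
  other, have different integrals of \<open>1 / (1 + x\<^sup>2)\<close>: consecutive values differ by
  \<open>1 / kernel n\<close>, which stays away from \<open>0\<close>.\<close>

lemma kernel_bounded_imp_not_unique:
  assumes bounded: "\<And>n. kernel n \<le> C"
  shows "\<exists>\<nu>' \<nu>''. has_moments \<nu>' M \<and> has_moments \<nu>'' M \<and> \<nu>' \<noteq> \<nu>''"
proof -
  have "\<exists>\<nu>. real_distribution \<nu> \<and> (\<forall>p. integrable \<nu> (poly p)) \<and>
    (\<forall>p. degree p < 2 * Suc (Suc n) \<longrightarrow> integral\<^sup>L \<nu> (poly p) = L p) \<and>
    (\<integral>x. 1 / (1 + x\<^sup>2) \<partial>\<nu>) = num (Suc (Suc n)) / den (Suc (Suc n))" for n
    by (rule gauss_measure_convergent[of "Suc (Suc n)"]) auto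
  then obtain G where G: "\<And>n. real_distribution (G n)"
    and int: "\<And>n p. integrable (G n) (poly p)"
    and exact: "\<And>n p. degree p < 2 * Suc (Suc n) \<Longrightarrow> integral\<^sup>L (G n) (poly p) = L p"
    and F: "\<And>n. (\<integral>x. 1 / (1 + x\<^sup>2) \<partial>G n) = num (Suc (Suc n)) / den (Suc (Suc n))"
    by metis
  have power: "poly (monom 1 k) = (\<lambda>x :: real. x ^ k)" for k
    by (simp add: fun_eq_iff poly_monom)
  have M: "L (monom 1 k) = M k" for k
    using moments has_moments_integral_poly[OF moments, of "monom 1 k"]
    by (simp add: power has_moments_def has_bochner_integral_iff)
  \<comment> \<open>The shift by two in the index gives every \<open>G n\<close> the second moment \<open>M 2\<close>, needed for
    tightness.\<close>
  have mom: "has_bochner_integral (G n) (\<lambda>x. x ^ k) (M k)" if "k \<le> n \<or> k = 2" for n k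
    using int[of n "monom 1 k"] exact[of "monom 1 k" n] that
    by (auto simp: power has_bochner_integral_iff M degree_monom_eq)
  have tight: "tight G"
    using mom[of 2]
    by (intro tight_if_second_moments_bounded[of _ "M 2"] G) (auto simp: has_bochner_integral_iff)
  have limit_moments: "has_moments \<nu>' M"
    if "strict_mono r" "real_distribution \<nu>'" "weak_conv_m (G \<circ> r) \<nu>'" for r \<nu>'
  proof (rule has_moments_weak_limit[OF _ that(2,3)])
    show "\<forall>\<^sub>F n in sequentially. has_bochner_integral ((G \<circ> r) n) (\<lambda>x. x ^ k) (M k)" for k
      using eventually_ge_at_top[of k]
    proof eventually_elim
      case (elim n)
      then show ?case
        using seq_suble[OF that(1), of n] by (auto intro!: mom)
    qed
  qed (simp add: G)
  have limit_F: "(\<lambda>n. \<integral>x. 1 / (1 + x\<^sup>2) \<partial>G (r n)) \<longlonglongrightarrow> (\<integral>x. 1 / (1 + x\<^sup>2) \<partial>\<nu>')"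
    if "real_distribution \<nu>'" "weak_conv_m (G \<circ> r) \<nu>'" for r \<nu>'
  proof -
    have "(\<lambda>n. \<integral>x. 1 / (1 + x\<^sup>2) \<partial>(G \<circ> r) n) \<longlonglongrightarrow> (\<integral>x. 1 / (1 + x\<^sup>2) \<partial>\<nu>')"
    proof (rule weak_conv_imp_integral_bdd_continuous_conv[OF _ that, of _ 1])
      show "isCont (\<lambda>x. 1 / (1 + x\<^sup>2)) x" for x :: real
        using one_plus_square_pos[of x] by (intro continuous_intros) auto
      show "norm (1 / (1 + x\<^sup>2)) \<le> 1" for x :: real
        using one_plus_square_pos[of x] by simp
    qed (simp add: G)
    then show ?thesis by simp
  qed
  obtain r \<nu>' where r: "strict_mono r" "real_distribution \<nu>'" "weak_conv_m (G \<circ> r) \<nu>'"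
    using tight_imp_convergent_subsubsequence[OF tight strict_mono_id] by auto
  have s: "strict_mono (Suc \<circ> r)"
    using r(1) by (auto simp: strict_mono_def)
  obtain r' \<nu>'' where r': "strict_mono r'" "real_distribution \<nu>''" "weak_conv_m (G \<circ> (Suc \<circ> r) \<circ> r') \<nu>''"
    using tight_imp_convergent_subsubsequence[OF tight s] by auto
  have "(\<lambda>n. \<integral>x. 1 / (1 + x\<^sup>2) \<partial>G (r (r' n))) \<longlonglongrightarrow> (\<integral>x. 1 / (1 + x\<^sup>2) \<partial>\<nu>')"
    using LIMSEQ_subseq_LIMSEQ[OF limit_F[OF r(2,3)] r'(1)] by (simp add: o_def)
  moreover have "(\<lambda>n. \<integral>x. 1 / (1 + x\<^sup>2) \<partial>G (Suc (r (r' n)))) \<longlonglongrightarrow> (\<integral>x. 1 / (1 + x\<^sup>2) \<partial>\<nu>'')"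
    using limit_F[of \<nu>'' "Suc \<circ> r \<circ> r'"] r'(2,3) by (simp add: o_def)
  ultimately have lim: "(\<lambda>n. \<bar>(\<integral>x. 1 / (1 + x\<^sup>2) \<partial>G (Suc (r (r' n)))) - (\<integral>x. 1 / (1 + x\<^sup>2) \<partial>G (r (r' n)))\<bar>)
      \<longlonglongrightarrow> \<bar>(\<integral>x. 1 / (1 + x\<^sup>2) \<partial>\<nu>'') - (\<integral>x. 1 / (1 + x\<^sup>2) \<partial>\<nu>')\<bar>"
    by (intro tendsto_intros)
  have gap: "1 / C \<le> \<bar>(\<integral>x. 1 / (1 + x\<^sup>2) \<partial>G (Suc n)) - (\<integral>x. 1 / (1 + x\<^sup>2) \<partial>G n)\<bar>" for n
  proof -
    have "\<bar>(\<integral>x. 1 / (1 + x\<^sup>2) \<partial>G (Suc n)) - (\<integral>x. 1 / (1 + x\<^sup>2) \<partial>G n)\<bar> = 1 / kernel (Suc (Suc n))"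
      unfolding F convergent_difference using kernel_pos[of "Suc (Suc n)"]
      by (simp add: abs_divide power_abs)
    then show ?thesis
      using bounded[of "Suc (Suc n)"] kernel_pos[of "Suc (Suc n)"] by (simp add: frac_le)
  qed
  have "1 / C \<le> \<bar>(\<integral>x. 1 / (1 + x\<^sup>2) \<partial>\<nu>'') - (\<integral>x. 1 / (1 + x\<^sup>2) \<partial>\<nu>')\<bar>"
    by (rule tendsto_lowerbound[OF lim]) (auto intro!: always_eventually gap)
  moreover have "1 / C > 0"
    using bounded[of 0] kernel_pos[of 0] by simp
  ultimately have "\<nu>' \<noteq> \<nu>''"
    by auto
  moreover have "has_moments \<nu>' M"
    by (rule limit_moments[OF r])
  moreover have "has_moments \<nu>'' M"
    using r' s by (intro limit_moments[of "Suc \<circ> r \<circ> r'"]) (auto simp: o_assoc intro: strict_mono_o)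
  ultimately show ?thesis by blast
qed

end

section \<open>Measures determined by rational functions with poles at the imaginary units\<close>

lemma real_polynomial_function_compactified_line:
  fixes g :: "real \<times> real \<Rightarrow> real"
  assumes "real_polynomial_function g"
  shows "\<exists>p k. \<forall>x. g (1 / (1 + x\<^sup>2), x / (1 + x\<^sup>2)) = poly p x / (1 + x\<^sup>2) ^ k"
  using assms
proof (induction rule: real_polynomial_function.induct)
  case (linear f)
  then interpret bounded_linear f .
  have f: "f (u, v) = u * f (1, 0) + v * f (0, 1)" for u v
  proof -
    have "f (u, v) = f (u *\<^sub>R (1, 0) + v *\<^sub>R (0, 1))"
      by simp
    then show ?thesis
      by (simp only: add scale real_scaleR_def)
  qed
  have "f (1 / (1 + x\<^sup>2), x / (1 + x\<^sup>2)) = poly [:f (1, 0), f (0, 1):] x / (1 + x\<^sup>2) ^ 1" for x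
    by (subst f) (simp add: add_divide_distrib)
  then show ?case by blast
next
  case (const c)
  have "c = poly [:c:] x / (1 + x\<^sup>2) ^ 0" for x
    by simp
  then show ?case by blast
next
  case (add f g)
  then obtain p k q l where
    f: "\<And>x. f (1 / (1 + x\<^sup>2), x / (1 + x\<^sup>2)) = poly p x / (1 + x\<^sup>2) ^ k" and
    g: "\<And>x. g (1 / (1 + x\<^sup>2), x / (1 + x\<^sup>2)) = poly q x / (1 + x\<^sup>2) ^ l"
    by blast
  have "poly p x / (1 + x\<^sup>2) ^ k + poly q x / (1 + x\<^sup>2) ^ l =
      poly (p * [:1, 0, 1:] ^ l + q * [:1, 0, 1:] ^ k) x / (1 + x\<^sup>2) ^ (k + l)" for x
  proof -
    have "poly [:1, 0, 1:] x = 1 + x\<^sup>2"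
      by (simp add: power2_eq_square)
    then show ?thesis
      using one_plus_square_pos[of x]
      by (simp only: poly_add poly_mult poly_power power_add) (simp add: add_frac_eq)
  qed
  then show ?case
    unfolding f g by blast
next
  case (mult f g)
  then obtain p k q l where
    f: "\<And>x. f (1 / (1 + x\<^sup>2), x / (1 + x\<^sup>2)) = poly p x / (1 + x\<^sup>2) ^ k" and
    g: "\<And>x. g (1 / (1 + x\<^sup>2), x / (1 + x\<^sup>2)) = poly q x / (1 + x\<^sup>2) ^ l"
    by blast
  have "poly p x / (1 + x\<^sup>2) ^ k * (poly q x / (1 + x\<^sup>2) ^ l) = poly (p * q) x / (1 + x\<^sup>2) ^ (k + l)" for x
    by (simp add: power_add)
  then show ?case
    unfolding f g by blast
qed

text \<open>The map \<open>x \<mapsto> (1 / (1 + x\<^sup>2), x / (1 + x\<^sup>2))\<close> sends the line into a compact set, on which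
  polynomials in the two coordinates approximate every continuous function uniformly.  For
  \<open>f (u, v) = min 1 (n \<cdot> max 0 (v - a u))\<close> the composite with the map is positive exactly for \<open>x > a\<close>, so
  as \<open>n\<close> grows it tends to the indicator of a half-line.\<close>

lemma real_distribution_eqI_rational:
  assumes dist: "real_distribution \<nu>" "real_distribution \<nu>'"
    and int: "\<And>p k. integrable \<nu> (\<lambda>x. poly p x / (1 + x\<^sup>2) ^ k)"
      "\<And>p k. integrable \<nu>' (\<lambda>x. poly p x / (1 + x\<^sup>2) ^ k)"
    and eq: "\<And>p k. (\<integral>x. poly p x / (1 + x\<^sup>2) ^ k \<partial>\<nu>) = (\<integral>x. poly p x / (1 + x\<^sup>2) ^ k \<partial>\<nu>')"
  shows "\<nu> = \<nu>'"
proof -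
  interpret N: real_distribution \<nu> by fact
  interpret N': real_distribution \<nu>' by fact
  define \<phi> where "\<phi> x = (1 / (1 + x\<^sup>2), x / (1 + x\<^sup>2))" for x :: real
  define S where "S = {0..1 :: real} \<times> {-1..1 :: real}"
  have \<phi>: "\<phi> x \<in> S" for x
  proof -
    have "\<bar>x\<bar> \<le> 1 + x\<^sup>2"
      using zero_le_power2[of "\<bar>x\<bar> - 1"] by (simp add: power2_diff algebra_simps)
    then show ?thesis
      using one_plus_square_pos[of x] by (auto simp: \<phi>_def S_def field_simps abs_le_iff)
  qed
  define f where "f a n z = min 1 (real n * max 0 (snd z - a * fst z))" for a n and z :: "real \<times> real"
  have [measurable]: "(\<lambda>x. f a n (\<phi> x)) \<in> borel_measurable borel" for a n
    unfolding f_def \<phi>_def fst_conv snd_conv by measurable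
  have f_bound: "norm (f a n z) \<le> 1" for a n z
    by (simp add: f_def)
  have f_int: "integrable \<nu> (\<lambda>x. f a n (\<phi> x))" "integrable \<nu>' (\<lambda>x. f a n (\<phi> x))" for a n
    by (rule N.integrable_const_bound[of _ 1] N'.integrable_const_bound[of _ 1]; use f_bound in simp)+
  have f_eq: "(\<integral>x. f a n (\<phi> x) \<partial>\<nu>) = (\<integral>x. f a n (\<phi> x) \<partial>\<nu>')" for a n
  proof -
    have bound: "\<bar>(\<integral>x. f a n (\<phi> x) \<partial>\<nu>) - (\<integral>x. f a n (\<phi> x) \<partial>\<nu>')\<bar> \<le> 2 * e" if "e > 0" for e
    proof -
      have "compact S"
        unfolding S_def by (intro compact_Times compact_Icc)
      moreover have "continuous_on S (f a n)"
        unfolding f_def by (intro continuous_intros)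
      ultimately obtain g where g: "real_polynomial_function g" "\<And>z. z \<in> S \<Longrightarrow> \<bar>f a n z - g z\<bar> < e"
        using Stone_Weierstrass_real_polynomial_function \<open>e > 0\<close> by metis
      obtain p k where pk: "\<And>x. g (\<phi> x) = poly p x / (1 + x\<^sup>2) ^ k"
        using real_polynomial_function_compactified_line[OF g(1)] unfolding \<phi>_def by blast
      have close: "\<bar>(\<integral>x. f a n (\<phi> x) \<partial>N) - (\<integral>x. g (\<phi> x) \<partial>N)\<bar> \<le> e"
        if "real_distribution N" "integrable N (\<lambda>x. f a n (\<phi> x))" "integrable N (\<lambda>x. g (\<phi> x))" for N
      proof -
        interpret real_distribution N by fact
        have "\<bar>(\<integral>x. f a n (\<phi> x) \<partial>N) - (\<integral>x. g (\<phi> x) \<partial>N)\<bar> = \<bar>\<integral>x. f a n (\<phi> x) - g (\<phi> x) \<partial>N\<bar>"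
          using that by simp
        also have "\<dots> \<le> (\<integral>x. \<bar>f a n (\<phi> x) - g (\<phi> x)\<bar> \<partial>N)"
          by (rule integral_abs_bound)
        also have "\<dots> \<le> (\<integral>x. e \<partial>N)"
          using that g(2)[OF \<phi>] by (intro integral_mono) (auto intro: less_imp_le)
        finally show ?thesis using prob_space by simp
      qed
      have "(\<integral>x. g (\<phi> x) \<partial>\<nu>) = (\<integral>x. g (\<phi> x) \<partial>\<nu>')"
        unfolding pk by (rule eq)
      then show ?thesis
        using close[OF dist(1) f_int(1)] close[OF dist(2) f_int(2)] int unfolding pk by fastforce
    qed
    show ?thesis
    proof (rule ccontr)
      assume "\<not> ?thesis"
      then show False
        using bound[of "\<bar>(\<integral>x. f a n (\<phi> x) \<partial>\<nu>) - (\<integral>x. f a n (\<phi> x) \<partial>\<nu>')\<bar> / 4"] by simp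
    qed
  qed
  have f_limit: "(\<lambda>n. f a n (\<phi> x)) \<longlonglongrightarrow> indicat_real {a<..} x" for a x
  proof (cases "a < x")
    case True
    define d where "d = x / (1 + x\<^sup>2) - a / (1 + x\<^sup>2)"
    have "d > 0"
      using True one_plus_square_pos[of x] by (simp add: d_def divide_strict_right_mono)
    have "\<forall>\<^sub>F n in sequentially. f a n (\<phi> x) = 1"
      using eventually_ge_at_top[of "nat \<lceil>1 / d\<rceil>"]
    proof eventually_elim
      case (elim n)
      then have "1 / d \<le> real n"
        using real_nat_ceiling_ge[of "1 / d"] by linarith
      then have "1 \<le> real n * d"
        using \<open>d > 0\<close> by (simp add: field_simps)
      then show ?case
        using \<open>d > 0\<close> by (simp add: f_def \<phi>_def d_def)
    qed
    then show ?thesis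
      using True by (simp add: tendsto_eventually)
  next
    case False
    then have "x / (1 + x\<^sup>2) \<le> a / (1 + x\<^sup>2)"
      using one_plus_square_pos[of x] by (simp add: divide_right_mono)
    then show ?thesis
      using False by (simp add: f_def \<phi>_def)
  qed
  have lim: "(\<lambda>n. \<integral>x. f a n (\<phi> x) \<partial>N) \<longlonglongrightarrow> measure N {a<..}" if "real_distribution N" for a N
  proof -
    interpret real_distribution N by fact
    have "(\<lambda>n. \<integral>x. f a n (\<phi> x) \<partial>N) \<longlonglongrightarrow> (\<integral>x. indicat_real {a<..} x \<partial>N)"
      by (rule integral_dominated_convergence[where w = "\<lambda>_. 1"]) (use f_limit f_bound in auto)
    then show ?thesis by simp
  qed
  have "measure \<nu> {a<..} = measure \<nu>' {a<..}" for a
    using lim[OF dist(1), of a] lim[OF dist(2), of a] unfolding f_eq by (rule LIMSEQ_unique)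
  moreover have "cdf N a = 1 - measure N {a<..}" if "real_distribution N" for a N
  proof -
    interpret real_distribution N by fact
    have "{..a} = space N - {a<..}" by auto
    then show ?thesis
      using prob_compl[of "{a<..}"] by (simp add: cdf_def)
  qed
  ultimately have "cdf \<nu> = cdf \<nu>'"
    using dist by (simp add: fun_eq_iff)
  then show ?thesis
    using cdf_unique dist by blast
qed

section \<open>Unbounded kernels force uniqueness\<close>

lemma integrable_poly_over_power:
  assumes "has_moments \<nu> M"
  shows "integrable \<nu> (\<lambda>x. poly p x / (1 + x\<^sup>2) ^ k)"
proof (rule Bochner_Integration.integrable_bound)
  interpret real_distribution \<nu>
    using assms by (rule has_moments_real_distribution)
  show "integrable \<nu> (poly p)"
    using assms by (rule has_moments_integrable_poly)
  show "(\<lambda>x. poly p x / (1 + x\<^sup>2) ^ k) \<in> borel_measurable \<nu>"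
    by simp
  have "\<bar>poly p x\<bar> / (1 + x\<^sup>2) ^ k \<le> \<bar>poly p x\<bar>" for x
    using one_plus_square_pos[of x] mult_left_mono[OF one_le_power[of "1 + x\<^sup>2" k], of "\<bar>poly p x\<bar>"]
    by (simp add: field_simps)
  then show "AE x in \<nu>. norm (poly p x / (1 + x\<^sup>2) ^ k) \<le> norm (poly p x)"
    using one_plus_square_pos by (auto simp: abs_divide power_abs abs_of_pos)
qed

lemma (in prob_space) expectation_square_le:
  fixes X :: "'a \<Rightarrow> real"
  assumes "integrable M X" "integrable M (\<lambda>x. (X x)\<^sup>2)"
  shows "(expectation X)\<^sup>2 \<le> expectation (\<lambda>x. (X x)\<^sup>2)"
  using variance_eq[OF assms] variance_positive[of X] by linarith

context jacobi_moment_problem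
begin

lemma W_eq_den_mod: "[:1, 0, 1:] dvd W n - [:den n:]"
proof (induction n rule: num.induct)
  case 1
  then show ?case by (simp add: W_0 one_pCons)
next
  case 2
  have "W (Suc 0) - [:den (Suc 0):] = [:1, 0, 1:] * (- 1)"
    by (simp add: W_1 one_pCons)
  then show ?case by (rule dvdI)
next
  case (3 n)
  have "W (Suc (Suc n)) - [:den (Suc (Suc n)):] = (W (Suc n) - [:den (Suc n):]) +
      smult (\<omega> (Suc n)) (W n - [:den n:]) - (if odd n then [:1, 0, 1:] * D (Suc n) else 0)"
    by (simp add: W_rec smult_diff_right)
  also have "[:1, 0, 1:] dvd \<dots>"
    by (rule dvd_diff[OF dvd_add[OF 3(1) dvd_smult[OF 3(2)]]]) (simp del: mult_pCons_left)
  finally show ?case .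
qed

lemma L_D_sum_square:
  assumes "finite I"
  shows "L ((\<Sum>k\<in>I. smult (den k / h k) (D k)) * (\<Sum>k\<in>I. smult (den k / h k) (D k))) = (\<Sum>k\<in>I. (den k)\<^sup>2 / h k)"
proof -
  have D: "L (D j * D k) = (if j = k then h k else 0)" for j k
    by (simp add: D_def L_smult L_P_square L_P_orthogonal flip: power_mult_distrib mult.assoc power_add)
  have "L ((\<Sum>k\<in>I. smult (den k / h k) (D k)) * (\<Sum>k\<in>I. smult (den k / h k) (D k))) =
      (\<Sum>j\<in>I. \<Sum>k\<in>I. den j / h j * (den k / h k) * L (D j * D k))"
    by (simp add: sum_product L_sum L_smult mult_ac)
  also have "\<dots> = (\<Sum>j\<in>I. \<Sum>k\<in>I. if j = k then (den k)\<^sup>2 / h k else 0)"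
  proof (intro sum.cong refl)
    fix j k
    show "den j / h j * (den k / h k) * L (D j * D k) = (if j = k then (den k)\<^sup>2 / h k else 0)"
      using h_pos[of k] by (simp add: D power2_eq_square)
  qed
  also have "\<dots> = (\<Sum>k\<in>I. (den k)\<^sup>2 / h k)"
    using assms by simp
  finally show ?thesis .
qed

text \<open>At \<open>x = i\<close> this is \<open>kernel N\<close>, as is the reproducing kernel \<open>(\<Sum>k\<le>N. P\<^sub>k(x) cnj (P\<^sub>k(i)) / h k)\<close>; in the latter the
  terms of odd index carry a factor \<open>- i\<close>, which is replaced here by \<open>- x\<close> to keep the
  coefficients real.\<close>

definition kernel_poly :: "nat \<Rightarrow> real poly" where
  "kernel_poly N = (\<Sum>k\<le>N. smult (den k / h k) (W k))"

lemma kernel_poly_mod: "\<exists>R. kernel_poly N = [:kernel N:] + [:1, 0, 1:] * R"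
proof -
  have "kernel_poly N - [:kernel N:] = (\<Sum>k\<le>N. smult (den k / h k) (W k - [:den k:]))"
  proof (induction N)
    case 0
    then show ?case by (simp add: kernel_poly_def kernel_def smult_diff_right)
  next
    case (Suc N)
    then show ?case
      by (simp add: kernel_poly_def kernel_def smult_diff_right power2_eq_square algebra_simps
          del: h_Suc)
  qed
  also have "[:1, 0, 1:] dvd \<dots>"
    by (intro dvd_sum dvd_smult W_eq_den_mod)
  finally show ?thesis
    by (metis add_diff_cancel_left' diff_add_cancel dvdE add.commute)
qed

text \<open>The even and odd parts of the reproducing kernel are \<open>E\<close> and \<open>- i F\<close> with real \<open>E\<close>, \<open>F\<close>, and
  \<open>kernel_poly N = E - x F\<close>.  By Cauchy--Schwarz its square is at most \<open>(1 + x\<^sup>2) (E\<^sup>2 + F\<^sup>2)\<close>.  By the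
  reproducing property \<open>E\<^sup>2 + F\<^sup>2\<close> integrates to \<open>kernel N\<close>.\<close>

lemma kernel_poly_integral_bound:
  assumes "has_moments \<nu> M" "e \<le> 1"
  shows "(\<integral>x. poly (monom 1 e * kernel_poly N) x / (1 + x\<^sup>2) ^ Suc k \<partial>\<nu>)\<^sup>2 \<le> kernel N"
proof -
  interpret real_distribution \<nu>
    using assms(1) by (rule has_moments_real_distribution)
  define E where "E = (\<Sum>k \<in> {k. k \<le> N \<and> even k}. smult (den k / h k) (D k))"
  define F where "F = (\<Sum>k \<in> {k. k \<le> N \<and> odd k}. smult (den k / h k) (D k))"
  have split: "{..N} = {k. k \<le> N \<and> even k} \<union> {k. k \<le> N \<and> odd k}"
    by auto
  have "kernel_poly N = (\<Sum>k \<in> {k. k \<le> N \<and> even k}. smult (den k / h k) (W k)) +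
      (\<Sum>k \<in> {k. k \<le> N \<and> odd k}. smult (den k / h k) (W k))"
    unfolding kernel_poly_def split by (rule sum.union_disjoint) auto
  also have "(\<Sum>k \<in> {k. k \<le> N \<and> even k}. smult (den k / h k) (W k)) = E"
    unfolding E_def by (intro sum.cong) (auto simp: W_def)
  also have "(\<Sum>k \<in> {k. k \<le> N \<and> odd k}. smult (den k / h k) (W k)) = - [:0, 1:] * F"
    unfolding F_def sum_distrib_left by (intro sum.cong) (auto simp: W_def)
  finally have T: "poly (kernel_poly N) x = poly E x - x * poly F x" for x
    by simp
  have "L (E * E + F * F) = (\<Sum>k \<in> {k. k \<le> N \<and> even k}. (den k)\<^sup>2 / h k) + (\<Sum>k \<in> {k. k \<le> N \<and> odd k}. (den k)\<^sup>2 / h k)"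
    unfolding E_def F_def by (simp add: L_add L_D_sum_square)
  also have "\<dots> = kernel N"
    unfolding kernel_def split by (rule sum.union_disjoint[symmetric]) auto
  finally have EF: "L (E * E + F * F) = kernel N" .
  let ?X = "\<lambda>x. poly (monom 1 e * kernel_poly N) x / (1 + x\<^sup>2) ^ Suc k"
  have pointwise: "(?X x)\<^sup>2 \<le> poly (E * E + F * F) x" for x
  proof -
    have "(poly (kernel_poly N) x)\<^sup>2 \<le> (1 + x\<^sup>2) * poly (E * E + F * F) x"
      unfolding T using zero_le_power2[of "x * poly E x + poly F x"]
      by (simp add: power2_eq_square algebra_simps)
    moreover have "(x ^ e)\<^sup>2 \<le> 1 + x\<^sup>2"
      using assms(2) by (cases e) auto
    ultimately have "(x ^ e)\<^sup>2 * (poly (kernel_poly N) x)\<^sup>2 \<le> (1 + x\<^sup>2) * ((1 + x\<^sup>2) * poly (E * E + F * F) x)"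
      by (intro mult_mono) auto
    also have "\<dots> = poly (E * E + F * F) x * (1 + x\<^sup>2)\<^sup>2"
      by (simp add: power2_eq_square)
    also have "\<dots> \<le> poly (E * E + F * F) x * ((1 + x\<^sup>2) ^ Suc k)\<^sup>2"
      using self_le_power[of "1 + x\<^sup>2" "Suc k"] by (intro mult_left_mono power_mono) auto
    finally show ?thesis
      using one_plus_square_pos[of x]
      by (simp add: power_divide poly_monom power_mult_distrib pos_divide_le_eq del: power_Suc)
  qed
  have X2: "integrable \<nu> (\<lambda>x. (?X x)\<^sup>2)"
  proof -
    have "(?X x)\<^sup>2 = poly ((monom 1 e * kernel_poly N)\<^sup>2) x / (1 + x\<^sup>2) ^ (Suc k * 2)" for x
      by (simp only: power_divide poly_power power_mult)
    then show ?thesis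
      using integrable_poly_over_power[OF assms(1)] by presburger
  qed
  have "(integral\<^sup>L \<nu> ?X)\<^sup>2 \<le> (\<integral>x. (?X x)\<^sup>2 \<partial>\<nu>)"
    by (intro expectation_square_le integrable_poly_over_power[OF assms(1)] X2)
  also have "\<dots> \<le> integral\<^sup>L \<nu> (poly (E * E + F * F))"
    by (intro integral_mono X2 has_moments_integrable_poly[OF assms(1)] pointwise)
  also have "\<dots> = kernel N"
    by (simp only: has_moments_integral_poly[OF assms(1)] EF)
  finally show ?thesis .
qed

text \<open>Write \<open>kernel_poly N = kernel N + (1 + x\<^sup>2) R\<close>.  By the induction hypothesis
  \<open>x\<^sup>e R / (1 + x\<^sup>2)\<^sup>k\<close> has the same integral for both measures.  So
  \<open>kernel N\<close> times the difference of the integrals of \<open>x\<^sup>e / (1 + x\<^sup>2)\<^sup>k\<^sup>+\<^sup>1\<close> equals a difference of two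
  integrals of size at most \<open>sqrt (kernel N)\<close>, and letting \<open>kernel N\<close> grow gives equality for
  \<open>e \<le> 1\<close>.  Division with remainder by \<open>1 + x\<^sup>2\<close> reduces all numerators to these.\<close>

lemma rational_integrals_determined:
  assumes unbounded: "\<And>C. \<exists>N. kernel N > C"
    and mom: "has_moments \<nu> M" "has_moments \<nu>' M"
  shows "(\<integral>x. poly p x / (1 + x\<^sup>2) ^ k \<partial>\<nu>) = (\<integral>x. poly p x / (1 + x\<^sup>2) ^ k \<partial>\<nu>')"
proof (induction k arbitrary: p)
  case 0
  have "(\<integral>x. poly p x \<partial>N) = L p" if "has_moments N M" for N
    using has_moments_integral_poly[OF that, of p] by simp
  then show ?case
    using mom by simp
next
  case (Suc k)
  have monom: "(\<integral>x. x ^ e / (1 + x\<^sup>2) ^ Suc k \<partial>\<nu>) = (\<integral>x. x ^ e / (1 + x\<^sup>2) ^ Suc k \<partial>\<nu>')" if "e \<le> 1" for e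
  proof (rule ccontr)
    let ?J = "\<lambda>N. \<integral>x. x ^ e / (1 + x\<^sup>2) ^ Suc k \<partial>N"
    assume "?J \<nu> \<noteq> ?J \<nu>'"
    then have "(?J \<nu> - ?J \<nu>')\<^sup>2 > 0"
      by simp
    moreover obtain N where N: "kernel N > 4 / (?J \<nu> - ?J \<nu>')\<^sup>2"
      using unbounded by blast
    ultimately have gt: "kernel N * (?J \<nu> - ?J \<nu>')\<^sup>2 > 4"
      by (simp add: field_simps)
    obtain R where R: "kernel_poly N = [:kernel N:] + [:1, 0, 1:] * R"
      using kernel_poly_mod by blast
    have R': "poly (kernel_poly N) x = kernel N + (1 + x\<^sup>2) * poly R x" for x
      by (simp add: R power2_eq_square algebra_simps)
    let ?I = "\<lambda>N'. \<integral>x. poly (monom 1 e * kernel_poly N) x / (1 + x\<^sup>2) ^ Suc k \<partial>N'"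
    have I: "?I N' = kernel N * ?J N' + (\<integral>x. poly (monom 1 e * R) x / (1 + x\<^sup>2) ^ k \<partial>N')"
      if "has_moments N' M" for N'
    proof -
      have "integrable N' (\<lambda>x. x ^ e / (1 + x\<^sup>2) ^ Suc k)"
        using integrable_poly_over_power[OF that, of "monom 1 e" "Suc k"] by (simp add: poly_monom)
      moreover have "integrable N' (\<lambda>x. poly (monom 1 e * R) x / (1 + x\<^sup>2) ^ k)"
        by (rule integrable_poly_over_power[OF that])
      moreover have "poly (monom 1 e * kernel_poly N) x / (1 + x\<^sup>2) ^ Suc k =
          kernel N * (x ^ e / (1 + x\<^sup>2) ^ Suc k) + poly (monom 1 e * R) x / (1 + x\<^sup>2) ^ k" for x
      proof -
        have "y * (c + w * r) / (w * v) = c * (y / (w * v)) + y * r / v" if "w \<noteq> 0" for w v y c r :: real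
          using that by (simp add: distrib_left add_divide_distrib)
        from this[of "1 + x\<^sup>2" "x ^ e" "kernel N" "poly R x" "(1 + x\<^sup>2) ^ k"] show ?thesis
          using one_plus_square_pos[of x]
          by (simp only: R' poly_mult poly_monom power_Suc mult_1_left)
      qed
      moreover have "(\<integral>x. c * f x + g x \<partial>N') = c * integral\<^sup>L N' f + integral\<^sup>L N' g"
        if "integrable N' f" "integrable N' g" for f g and c :: real
        using that by simp
      ultimately show ?thesis
        by presburger
    qed
    have "kernel N * (?J \<nu> - ?J \<nu>') = ?I \<nu> - ?I \<nu>'"
      unfolding I[OF mom(1)] I[OF mom(2)] Suc.IH[of "monom 1 e * R"] right_diff_distrib by linarith
    then have "(kernel N * (?J \<nu> - ?J \<nu>'))\<^sup>2 = (?I \<nu> - ?I \<nu>')\<^sup>2"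
      by simp
    also have "\<dots> \<le> 2 * (?I \<nu>)\<^sup>2 + 2 * (?I \<nu>')\<^sup>2"
    proof -
      have "(a - b)\<^sup>2 \<le> 2 * a\<^sup>2 + 2 * b\<^sup>2" for a b :: real
        using zero_le_power2[of "a + b"] by (simp add: power2_sum power2_diff)
      then show ?thesis .
    qed
    also have "\<dots> \<le> 4 * kernel N"
      using kernel_poly_integral_bound[OF mom(1) that, of N k]
        kernel_poly_integral_bound[OF mom(2) that, of N k] by linarith
    finally have "kernel N * (kernel N * (?J \<nu> - ?J \<nu>')\<^sup>2) \<le> kernel N * 4"
      by (simp only: power_mult_distrib power2_eq_square[of "kernel N"] mult_ac)
    then have "kernel N * (?J \<nu> - ?J \<nu>')\<^sup>2 \<le> 4"
      by (rule mult_left_le_imp_le) (rule kernel_pos)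
    with gt show False by linarith
  qed
  let ?w = "[:1, 0, 1 :: real:]"
  define q where "q = p div ?w"
  define r where "r = p mod ?w"
  have "degree r \<le> 1"
    using degree_mod_less[of ?w p] by (auto simp: r_def)
  then have r: "poly r x = coeff r 0 + coeff r 1 * x" for x
    by (cases "degree r") (auto simp: poly_altdef coeff_eq_0)
  have "p = ?w * q + r"
    unfolding q_def r_def by (rule mult_div_mod_eq[symmetric])
  then have "poly p x = poly (?w * q + r) x" for x
    by (rule arg_cong)
  then have p: "poly p x = (1 + x\<^sup>2) * poly q x + (coeff r 0 + coeff r 1 * x)" for x
    by (simp add: r power2_eq_square algebra_simps)
  have "(\<integral>x. poly p x / (1 + x\<^sup>2) ^ Suc k \<partial>N) = (\<integral>x. poly q x / (1 + x\<^sup>2) ^ k \<partial>N) +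
      coeff r 0 * (\<integral>x. x ^ 0 / (1 + x\<^sup>2) ^ Suc k \<partial>N) + coeff r 1 * (\<integral>x. x ^ 1 / (1 + x\<^sup>2) ^ Suc k \<partial>N)"
    if "has_moments N M" for N
  proof -
    have "integrable N (\<lambda>x. x ^ e / (1 + x\<^sup>2) ^ Suc k)" for e
      using integrable_poly_over_power[OF that, of "monom 1 e" "Suc k"] by (simp add: poly_monom)
    moreover have "integrable N (\<lambda>x. poly q x / (1 + x\<^sup>2) ^ k)"
      by (rule integrable_poly_over_power[OF that])
    moreover have "poly p x / (1 + x\<^sup>2) ^ Suc k = poly q x / (1 + x\<^sup>2) ^ k +
        coeff r 0 * (x ^ 0 / (1 + x\<^sup>2) ^ Suc k) + coeff r 1 * (x ^ 1 / (1 + x\<^sup>2) ^ Suc k)" for x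
      using one_plus_square_pos[of x] by (simp add: p add_divide_distrib)
    moreover have "(\<integral>x. f x + a * g x + b * h x \<partial>N) = integral\<^sup>L N f + a * integral\<^sup>L N g + b * integral\<^sup>L N h"
      if "integrable N f" "integrable N g" "integrable N h" for f g h and a b :: real
      using that by simp
    ultimately show ?thesis
      by presburger
  qed
  then show ?case
    using mom monom[of 0] monom[of 1] Suc.IH[of q] by simp
qed

lemma kernel_unbounded_imp_unique:
  assumes "\<And>C. \<exists>N. kernel N > C" "has_moments \<nu> M" "has_moments \<nu>' M"
  shows "\<nu> = \<nu>'"
  using assms
  by (intro real_distribution_eqI_rational rational_integrals_determined integrable_poly_over_power
      has_moments_real_distribution) auto

end

section \<open>The equivalence\<close>

theorem theorem5p1:
  fixes M \<omega> :: "nat \<Rightarrow> real"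
  assumes "\<exists>\<mu>. has_moments \<mu> M"
    and "\<forall>n. odd n \<longrightarrow> M n = 0"
    and "jacobi_sequence M \<omega>"
    and "\<forall>n\<ge>1. \<omega> n > 0"
  shows "property_SC \<omega> \<longleftrightarrow> (\<exists>\<mu> \<nu>. has_moments \<mu> M \<and> has_moments \<nu> M \<and> \<mu> \<noteq> \<nu>)"
proof -
  obtain \<mu> where "has_moments \<mu> M"
    using assms(1) by blast
  moreover obtain P where "monic_orthogonal M P" "[:0, 1:] * P 0 = P 1"
    "\<And>n. n \<ge> 1 \<Longrightarrow> [:0, 1:] * P n = P (n + 1) + smult (\<omega> n) (P (n - 1))"
    using assms(3) unfolding jacobi_sequence_def by blast
  ultimately interpret jacobi_moment_problem \<mu> M \<omega> P
    using assms(4) by unfold_locales auto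
  show ?thesis
    unfolding property_SC_iff_kernel_bounded
    using kernel_bounded_imp_not_unique kernel_unbounded_imp_unique by (meson not_le)
qed

end
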